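(* Let $M$ be a number field and $\mathcal O_M$ the ring of integers of $M$. For a given integer $a\in\mathcal O_M$ with $a(4a+27)\neq0$, there exist only finitely many integers $b\in\mathcal O_M$ such that $\mathrm{Spl}_M(X^3+aX+a)=\mathrm{Spl}_M(X^3+bX+b)$.
   Context: $\mathrm{Spl}_M f$ denotes the splitting field of $f$ over $M$ in a fixed algebraic closure of $M$. The discriminant of $X^3+aX+a$ is $-a^2(4a+27)$. *)

theory Defs
  imports "HOL-Algebra.Algebraic_Closure_Type" "HOL-Algebra.Generated_Fields"
begin

text \<open>
  The field is the whole type \<open>'m\<close>; its fixed algebraic closure is the type \<open>'m alg_closure\<close>,
  into which it is embedded by \<^const>\<open>to_ac\<close>.
\<close>

definition number_field :: "'m::field_char_0 itself \<Rightarrow> bool" where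
  "number_field (_ :: 'm itself) \<longleftrightarrow>
     (\<exists>B. finite_dimensional_vector_space (\<lambda>(q::rat) (x::'m). of_rat q * x) B)"

definition ring_of_integers :: "'m::field_char_0 set" where
  "ring_of_integers = {x. algebraic_int x}"

text \<open>
  Splitting fields are compared as subsets of the closure, so that equality means equality of
  subfields and not merely isomorphism.
\<close>

definition splitting_field :: "'m::field poly \<Rightarrow> 'm alg_closure set" where
  "splitting_field f =
     generate_field ring_of_type_algebra (range to_ac \<union> {x. poly (map_poly to_ac f) x = 0})"

end

(* Dividing the roots of X^3 + b X + b by each other turns an integer b with the given splitting field L
   into a solution of the unit equation x + y = 1 in L, because
   b x^2 (1 - x)^2 + (x^2 - x + 1)^3 = 0 is monic in x with constant term 1. Finiteness of the solutions
   is shown as by Beukers and Schlickewei: integrals of t^m (t - 1)^n (t - x)^l between 0, 1 and x are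
   Pade approximations, which turn a solution x and a much larger solution z whose logarithmic vector
   points in nearly the same direction into a nonzero algebraic integer of norm less than 1. *)

theory Submission
  imports Defs "Jordan_Normal_Form.Char_Poly"
begin

section \<open>Pade approximation\<close>

text \<open>For roots r, s, t of the cubic, r + s + t = 0 gives (- s / t) + (- r / t) = 1. From x =
  - s / t one recovers b = - (x^2 - x + 1)^3 / (x^2 (1 - x)^2), up to a constant the j-invariant as
  a function of lambda. Its symmetry under x -> 1 / x and x -> 1 - x makes x and 1 - x units, so
  only archimedean absolute values enter. Two obstacles shape the argument. The determinant built
  from one approximation may vanish for given x and z, so each N comes with two approximations, e =
  0 and e = 1, which cannot both fail. And L lies in an abstract closure, whereas norms need
  embeddings into the complex numbers; so L is placed inside Q(\<theta>), and \<theta> is sent to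
  the complex roots of its minimal polynomial. \<open>padeE m n l u v\<close> is (m + n + l + 1)! /
  (m! n! l!) times the integral of (t - a)^m (t - b)^n (t - c)^l from b to c, divided by (- 1)^l (c
  - b)^(n + l + 1), where u = b - a and v = c - b. This normalisation leaves integer
  coefficients.\<close>

definition padeE :: "nat \<Rightarrow> nat \<Rightarrow> nat \<Rightarrow> 'a::comm_ring_1 \<Rightarrow> 'a \<Rightarrow> 'a" where
  "padeE m n l u v =
     (\<Sum>k\<le>m. of_nat ((m + n + l + 1) choose (m - k)) * of_nat ((n + k) choose k) * u ^ (m - k) * v ^ k)"

section \<open>Formal integration of polynomials\<close>

lemma ex_antiderivative: "\<exists>F. pderiv F = (p :: 'a::field_char_0 poly)"
proof -
  define F where "F = (\<Sum>i\<le>Polynomial.degree p. Polynomial.monom (Polynomial.coeff p i / of_nat (Suc i)) (Suc i))"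
  have "pderiv F = (\<Sum>i\<le>Polynomial.degree p. Polynomial.monom (Polynomial.coeff p i) i)"
    unfolding F_def higher_pderiv_sum[of 1, simplified]
    by (intro sum.cong refl) (simp add: pderiv_monom del: of_nat_Suc)
  also have "\<dots> = p" by (rule poly_as_sum_of_monoms)
  finally show ?thesis by blast
qed

text \<open>The choice of antiderivative cancels in the difference. A formal integral admits
  arbitrary field elements as endpoints, so the identities hold before any complex embedding is
  chosen.\<close>

definition pint :: "'a::field_char_0 poly \<Rightarrow> 'a \<Rightarrow> 'a \<Rightarrow> 'a" where
  "pint p b c = (let F = (SOME F. pderiv F = p) in poly F c - poly F b)"

lemma pintI:
  assumes "pderiv F = p"
  shows "pint p b c = poly F c - poly F b"
proof -
  define G where "G = (SOME F. pderiv F = p)"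
  have "pderiv G = p" unfolding G_def by (rule someI[of _ F]) (rule assms)
  hence "pderiv (G - F) = 0" using assms by (simp add: pderiv_diff)
  then obtain h where "G - F = [:h:]" using pderiv_iszero by blast
  hence G: "G = F + [:h:]" by (simp add: algebra_simps)
  have "pint p b c = poly G c - poly G b" by (simp add: pint_def G_def Let_def)
  thus ?thesis by (simp add: G)
qed

lemma pint_add: "pint (p + q) b c = pint p b c + pint q b c"
proof -
  obtain F G where "pderiv F = p" "pderiv G = q" using ex_antiderivative by metis
  thus ?thesis by (subst pintI[of "F + G"]) (auto simp: pintI pderiv_add)
qed

lemma pint_smult: "pint (Polynomial.smult k p) b c = k * pint p b c"
proof -
  obtain F where "pderiv F = p" using ex_antiderivative by metis
  thus ?thesis by (subst pintI[of "Polynomial.smult k F"]) (auto simp: pintI pderiv_smult algebra_simps)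
qed

lemma pint_0 [simp]: "pint 0 b c = 0"
  by (subst pintI[of 0]) auto

lemma pint_sum: "pint (\<Sum>i\<in>A. f i) b c = (\<Sum>i\<in>A. pint (f i) b c)"
  by (induction A rule: infinite_finite_induct) (auto simp: pint_add)

lemma pint_combine: "pint p a b + pint p b c = pint p a c"
proof -
  obtain F where "pderiv F = p" using ex_antiderivative by metis
  thus ?thesis by (simp add: pintI)
qed

text \<open>The Beta integral. Each step integrates by parts and trades a factor
  \<open>[:-c, 1:]\<close> for a factor \<open>[:-b, 1:]\<close>; the boundary term vanishes because
  the product is zero at both endpoints.\<close>

lemma pint_beta:
  "pint ([:-b, 1:] ^ n * [:-c, 1:] ^ l) b c =
     (- 1) ^ l * fact n * fact l / fact (n + l + 1) * (c - b) ^ (n + l + 1)"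
proof (induction l arbitrary: n)
  case 0
  have "pderiv (Polynomial.smult (1 / of_nat (Suc n)) ([:-b, 1:] ^ Suc n)) = [:-b, 1:] ^ n * [:-c, 1:] ^ 0"
    by (simp add: pderiv_smult pderiv_power_Suc pderiv_pCons del: of_nat_Suc power_Suc)
  from pintI[OF this, of b c] show ?case
    by (simp add: field_simps del: of_nat_Suc)
next
  case (Suc l)
  let ?u = "[:-b, 1:]" and ?v = "[:-c, 1:]"
  have d: "pderiv (?u ^ Suc n * ?v ^ Suc l) =
     Polynomial.smult (of_nat (Suc n)) (?u ^ n * ?v ^ Suc l) + Polynomial.smult (of_nat (Suc l)) (?u ^ Suc n * ?v ^ l)"
    by (simp add: pderiv_mult pderiv_power_Suc pderiv_pCons algebra_simps del: of_nat_Suc power_Suc)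
  have "of_nat (Suc n) * pint (?u ^ n * ?v ^ Suc l) b c + of_nat (Suc l) * pint (?u ^ Suc n * ?v ^ l) b c = 0"
    using pintI[OF d, of b c] by (simp only: pint_add pint_smult) simp
  hence "pint (?u ^ n * ?v ^ Suc l) b c = - of_nat (Suc l) / of_nat (Suc n) * pint (?u ^ Suc n * ?v ^ l) b c"
    by (simp add: field_simps add_eq_0_iff2 del: of_nat_Suc power_Suc)
  also have "\<dots> = - of_nat (Suc l) / of_nat (Suc n) *
     ((- 1) ^ l * fact (Suc n) * fact l / fact (Suc n + l + 1) * (c - b) ^ (Suc n + l + 1))"
    by (simp only: Suc)
  also have "\<dots> = (- 1) ^ Suc l * fact n * fact (Suc l) / fact (n + Suc l + 1) * (c - b) ^ (n + Suc l + 1)"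
  proof -
    have "fact (Suc n) = of_nat (Suc n) * (fact n :: 'a)" "fact (Suc l) = of_nat (Suc l) * (fact l :: 'a)"
      by (simp_all add: algebra_simps)
    thus ?thesis by (simp add: field_simps del: of_nat_Suc fact_Suc)
  qed
  finally show ?case .
qed

lemma pade_coeff:
  assumes "k \<le> m"
  shows "(fact (m + n + l + 1) / (fact m * fact n * fact l)) *
      (of_nat (m choose k) * (fact (n + k) * fact l / fact (n + k + l + 1))) =
      (of_nat ((m + n + l + 1) choose (m - k)) * of_nat ((n + k) choose k) :: 'a::field_char_0)"
proof -
  have 1: "of_nat (m choose k) = (fact m / (fact k * fact (m - k)) :: 'a)"
    using assms by (rule binomial_fact)
  have 2: "of_nat ((n + k) choose k) = (fact (n + k) / (fact k * fact n) :: 'a)"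
    by (subst binomial_fact) auto
  have 3: "of_nat ((m + n + l + 1) choose (m - k)) =
     (fact (m + n + l + 1) / (fact (m - k) * fact (n + k + l + 1)) :: 'a)"
  proof (subst binomial_fact)
    have "m + n + l + 1 - (m - k) = n + k + l + 1" using assms by simp
    thus "fact (m + n + l + 1) / (fact (m - k) * fact (m + n + l + 1 - (m - k))) =
      (fact (m + n + l + 1) / (fact (m - k) * fact (n + k + l + 1)) :: 'a)" by (simp only:)
  qed auto
  show ?thesis unfolding 1 2 3 by (simp add: field_simps del: fact_Suc)
qed

text \<open>Writing \<open>[:-a, 1:]\<close> as \<open>[:-b, 1:]\<close> plus the constant
  \<open>b - a\<close> and expanding reduces the integral to Beta integrals, whose factorials
  recombine into binomials.\<close>

lemma pint_padeE:
  fixes a b c :: "'a::field_char_0"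
  shows "fact (m + n + l + 1) / (fact m * fact n * fact l) *
      pint ([:-a, 1:] ^ m * [:-b, 1:] ^ n * [:-c, 1:] ^ l) b c =
    (- 1) ^ l * (c - b) ^ (n + l + 1) * padeE m n l (b - a) (c - b)"
proof -
  let ?u = "[:-b, 1:]" and ?v = "[:-c, 1:]"
  define D where "D = (fact (m + n + l + 1) / (fact m * fact n * fact l) :: 'a)"
  have "[:-a, 1:] = ?u + [:b - a:]" by simp
  hence "[:-a, 1:] ^ m = (\<Sum>k\<le>m. of_nat (m choose k) * ?u ^ k * [:b - a:] ^ (m - k))"
    by (simp only: binomial_ring)
  hence e: "[:-a, 1:] ^ m * ?u ^ n * ?v ^ l =
    (\<Sum>k\<le>m. Polynomial.smult (of_nat (m choose k) * (b - a) ^ (m - k)) (?u ^ (n + k) * ?v ^ l))"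
    by (simp add: sum_distrib_left sum_distrib_right poly_const_pow power_add of_nat_poly mult_ac)
  have "D * pint ([:-a, 1:] ^ m * ?u ^ n * ?v ^ l) b c =
    (\<Sum>k\<le>m. D * (of_nat (m choose k) * (fact (n + k) * fact l / fact (n + k + l + 1))) *
       ((-1) ^ l * (b - a) ^ (m - k) * (c - b) ^ (n + k + l + 1)))"
    unfolding e pint_sum pint_smult pint_beta by (simp add: sum_distrib_left mult_ac)
  also have "\<dots> = (\<Sum>k\<le>m. (of_nat ((m + n + l + 1) choose (m - k)) * of_nat ((n + k) choose k)) *
       ((-1) ^ l * (b - a) ^ (m - k) * (c - b) ^ (n + k + l + 1)))"
    unfolding D_def by (intro sum.cong refl) (subst pade_coeff, auto)
  also have "\<dots> = (- 1) ^ l * (c - b) ^ (n + l + 1) * padeE m n l (b - a) (c - b)"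
    unfolding padeE_def sum_distrib_left by (intro sum.cong refl) (simp add: power_add mult_ac)
  finally show ?thesis by (simp add: D_def)
qed

lemma order_antiderivative:
  fixes F :: "'a::field_char_0 poly"
  assumes "pderiv F \<noteq> 0" "[:-r, 1:] ^ N dvd pderiv F" "poly F r = 0"
  shows "Suc N \<le> Polynomial.order r F"
proof -
  have F: "F \<noteq> 0" using assms by auto
  have "Polynomial.order r F \<noteq> 0" using F assms(3) by (simp add: order_root)
  hence "Polynomial.order r F = Suc (Polynomial.order r (pderiv F))"
    using assms(3) F by (intro order_pderiv) auto
  moreover have "N \<le> Polynomial.order r (pderiv F)" using assms(1,2) by (simp add: order_divides)
  ultimately show ?thesis by simp
qed

text \<open>Up to a constant, an antiderivative \<open>F\<close> of \<open>g f\<close> would vanish to order \<open>N + 1\<close> at each of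
  \<open>a, b, c\<close>, which its degree of at most \<open>3 N + 2\<close> does not allow.\<close>

lemma pint_nondegenerate:
  fixes a b c :: "'a::field_char_0"
  assumes "distinct [a, b, c]" and "Polynomial.degree g \<le> 1"
    and f: "f = [:-a, 1:] ^ N * [:-b, 1:] ^ N * [:-c, 1:] ^ N"
    and "pint (g * f) a b = 0" "pint (g * f) a c = 0"
  shows "g = 0"
proof (rule ccontr)
  assume g: "g \<noteq> 0"
  obtain F0 where F0: "pderiv F0 = g * f" using ex_antiderivative by metis
  define F where "F = F0 - [:poly F0 a:]"
  have F: "pderiv F = g * f" by (simp add: F_def F0 pderiv_diff)
  have "poly F a = 0" by (simp add: F_def)
  moreover have "poly F b = 0" using assms(4) by (simp add: F_def pintI[OF F0])
  moreover have "poly F c = 0" using assms(5) by (simp add: F_def pintI[OF F0])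
  moreover have nz: "pderiv F \<noteq> 0" using g by (simp add: F f)
  moreover have "[:-a, 1:] ^ N dvd pderiv F" "[:-b, 1:] ^ N dvd pderiv F" "[:-c, 1:] ^ N dvd pderiv F"
    by (simp_all add: F f)
  ultimately have o: "Suc N \<le> Polynomial.order a F" "Suc N \<le> Polynomial.order b F"
    "Suc N \<le> Polynomial.order c F"
    by (auto intro: order_antiderivative)
  have F_nz: "F \<noteq> 0" using nz by auto
  have "{a, b, c} \<subseteq> {x. poly F x = 0}" using \<open>poly F a = 0\<close> \<open>poly F b = 0\<close> \<open>poly F c = 0\<close> by auto
  hence "(\<Sum>x\<in>{a, b, c}. Polynomial.order x F) \<le> (\<Sum>x | poly F x = 0. Polynomial.order x F)"
    using F_nz by (intro sum_mono2) (auto simp: poly_roots_finite)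
  also have "\<dots> \<le> Polynomial.degree F" by (rule sum_order_le_degree[OF F_nz])
  finally have "3 * Suc N \<le> Polynomial.degree F" using o assms(1) by simp
  moreover have "Polynomial.degree F \<le> Suc (Polynomial.degree (g * f))"
    using F degree_pderiv[of F] by simp
  moreover have "Polynomial.degree (g * f) \<le> 1 + 3 * N"
  proof -
    have "Polynomial.degree f = 3 * N" unfolding f
      by (subst degree_mult_eq, simp, simp, subst degree_mult_eq) (simp_all add: degree_power_eq)
    thus ?thesis using degree_mult_le[of g f] assms(2) by linarith
  qed
  ultimately show False by simp
qed

text \<open>The normalised integrals of t^(N + e) (t - 1)^N (t - x)^N from 0 to x, from 1 to x and
  from 0 to 1, with signs and the powers x^(2 N + 1) and (1 - x)^(2 N + 1) taken out. The first
  integral carries the power x^(2 N + 1 + e); the surplus \<open>x ^ e\<close> stays in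
  \<open>padeA\<close> so that both values of e share the same exponent.\<close>

definition padeA :: "nat \<Rightarrow> nat \<Rightarrow> 'a::comm_ring_1 \<Rightarrow> 'a" where
  "padeA e N x = x ^ e * padeE N (N + e) N (-1) x"
definition padeB :: "nat \<Rightarrow> nat \<Rightarrow> 'a::comm_ring_1 \<Rightarrow> 'a" where
  "padeB e N x = padeE (N + e) N N 1 (x - 1)"
definition padeC :: "nat \<Rightarrow> nat \<Rightarrow> 'a::comm_ring_1 \<Rightarrow> 'a" where
  "padeC e N x = padeE N (N + e) N (- x) 1"

context
  fixes N :: nat and x :: "'a::field_char_0" and f :: "nat \<Rightarrow> 'a poly" and D :: "nat \<Rightarrow> 'a"
  defines "f \<equiv> \<lambda>e. [:0, 1:] ^ (N + e) * [:-1, 1:] ^ N * [:-x, 1:] ^ N"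
    and "D \<equiv> \<lambda>e. fact (3 * N + e + 1) / (fact (N + e) * fact N * fact N)"
begin

lemma pint_padeA: "D e * pint (f e) 0 x = (- 1) ^ N * x ^ (2 * N + 1) * padeA e N x"
proof -
  have *: "N + (N + e) + N + 1 = 3 * N + e + 1" "N + e + N + 1 = 2 * N + 1 + e" by simp_all
  show ?thesis
    using pint_padeE[of N "N + e" N 1 0 x, unfolded *]
    by (simp add: f_def D_def padeA_def mult_ac power_add)
qed

lemma pint_padeB: "D e * pint (f e) 1 x = - ((- 1) ^ N * (1 - x) ^ (2 * N + 1) * padeB e N x)"
proof -
  have *: "N + e + N + N + 1 = 3 * N + e + 1" "N + N + 1 = 2 * N + 1" by simp_all
  have **: "(x - 1) ^ (2 * N + 1) = - ((1 - x) ^ (2 * N + 1))"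
    using power_minus_odd[of "2 * N + 1" "1 - x"] by simp
  show ?thesis
    using pint_padeE[of "N + e" N N 0 1 x, unfolded * **]
    by (simp add: f_def D_def padeB_def mult_ac)
qed

lemma pint_padeC: "D e * pint (f e) 0 1 = (- 1) ^ N * padeC e N x"
proof -
  have *: "N + (N + e) + N + 1 = 3 * N + e + 1" by simp
  show ?thesis
    using pint_padeE[of N "N + e" N x 0 1, unfolded *]
    by (simp add: f_def D_def padeC_def mult_ac)
qed

text \<open>Additivity of the integral over the path from 0 through 1 to x. Polynomials of degree at
  most N + e relate 1 to powers with exponent 2 N + 1, and this discrepancy drives the height
  bound.\<close>

lemma pade_identity:
  "x ^ (2 * N + 1) * padeA e N x + (1 - x) ^ (2 * N + 1) * padeB e N x = padeC e N x"
proof -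
  have "D e * pint (f e) 0 1 + D e * pint (f e) 1 x = D e * pint (f e) 0 x"
    by (simp add: pint_combine flip: distrib_left)
  hence "(- 1) ^ N * padeC e N x =
     (- 1) ^ N * (x ^ (2 * N + 1) * padeA e N x + (1 - x) ^ (2 * N + 1) * padeB e N x)"
    unfolding pint_padeA pint_padeB pint_padeC by (simp add: algebra_simps)
  thus ?thesis by simp
qed

text \<open>The two relations say that \<open>f 0\<close> times a polynomial of degree at most 1
  integrates to zero from 0 to x and from 0 to 1, so \<open>pint_nondegenerate\<close> applies.
  Degree 1 is the most that its count of zeros tolerates.\<close>

lemma pade_independent:
  assumes "x \<noteq> 0" "x \<noteq> 1"
    and "\<alpha> * padeA 0 N x + \<beta> * padeA 1 N x = 0" "\<alpha> * padeC 0 N x + \<beta> * padeC 1 N x = 0"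
  shows "\<alpha> = 0" "\<beta> = 0"
proof -
  define g where "g = [:\<alpha> * D 0, \<beta> * D 1:]"
  have f1: "f 1 = [:0, 1:] * f 0" by (simp add: f_def)
  have gf: "g * f 0 = Polynomial.smult (\<alpha> * D 0) (f 0) + Polynomial.smult (\<beta> * D 1) (f 1)"
    unfolding f1 g_def by simp
  have pg: "pint (g * f 0) b c = \<alpha> * (D 0 * pint (f 0) b c) + \<beta> * (D 1 * pint (f 1) b c)" for b c
    unfolding gf pint_add pint_smult by (simp add: mult_ac)
  have "pint (g * f 0) 0 x = (- 1) ^ N * x ^ (2 * N + 1) * (\<alpha> * padeA 0 N x + \<beta> * padeA 1 N x)"
    unfolding pg pint_padeA by (simp add: algebra_simps)
  moreover have "pint (g * f 0) 0 1 = (- 1) ^ N * (\<alpha> * padeC 0 N x + \<beta> * padeC 1 N x)"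
    unfolding pg pint_padeC by (simp add: algebra_simps)
  ultimately have "g = 0"
    using assms by (intro pint_nondegenerate[of 0 1 x g "f 0" N]) (auto simp: f_def g_def)
  moreover have "D 0 \<noteq> 0" "D 1 \<noteq> 0" by (simp_all add: D_def del: fact_Suc)
  ultimately show "\<alpha> = 0" "\<beta> = 0" by (auto simp: g_def)
qed

end

text \<open>Cramer's rule for the linear system A X + B Y = C, p X + q Y = 1, which is solved by X =
  \<open>x ^ (2 * N + 1)\<close> and Y = \<open>(1 - x) ^ (2 * N + 1)\<close>.\<close>

lemma pade_determinant:
  fixes x p q :: "'a::field_char_0"
  assumes "p * x ^ (2 * N + 1) + q * (1 - x) ^ (2 * N + 1) = 1"
  defines "\<Delta> \<equiv> \<lambda>e. padeA e N x * q - padeB e N x * p"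
  shows "\<Delta> e * x ^ (2 * N + 1) = q * padeC e N x - padeB e N x"
    and "\<Delta> e * (1 - x) ^ (2 * N + 1) = padeA e N x - p * padeC e N x"
proof -
  define P Q where "P = x ^ (2 * N + 1)" and "Q = (1 - x) ^ (2 * N + 1)"
  have 1: "p * P + q * Q = 1" using assms(1) by (simp add: P_def Q_def)
  have 2: "padeC e N x = P * padeA e N x + Q * padeB e N x"
    using pade_identity[of x N e] by (simp add: P_def Q_def)
  show "\<Delta> e * x ^ (2 * N + 1) = q * padeC e N x - padeB e N x"
    using arg_cong[OF 1, of "\<lambda>z. padeB e N x * z"]
    unfolding \<Delta>_def 2 P_def[symmetric] by (simp add: algebra_simps)
  show "\<Delta> e * (1 - x) ^ (2 * N + 1) = padeA e N x - p * padeC e N x"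
    using arg_cong[OF 1, of "\<lambda>z. padeA e N x * z"]
    unfolding \<Delta>_def 2 Q_def[symmetric] by (simp add: algebra_simps)
qed

text \<open>If both determinants vanished, then A = p C for e = 0 and e = 1 by Cramer's rule. A
  nontrivial combination that kills C would then kill A too, against
  \<open>pade_independent\<close>.\<close>

lemma pade_determinant_nonzero:
  fixes x p q :: "'a::field_char_0"
  assumes "p * x ^ (2 * N + 1) + q * (1 - x) ^ (2 * N + 1) = 1" and "x \<noteq> 0" "x \<noteq> 1" "p \<noteq> 0" "q \<noteq> 0"
  shows "\<exists>e\<le>1. padeA e N x * q - padeB e N x * p \<noteq> 0"
proof (rule ccontr)
  assume "\<not> ?thesis"
  hence z: "padeA e N x * q - padeB e N x * p = 0" if "e \<le> 1" for e using that by blast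
  have A: "padeA e N x = p * padeC e N x" if "e \<le> 1" for e
    using pade_determinant(2)[OF assms(1), of e] z[OF that] by simp
  have "\<exists>\<alpha> \<beta>. (\<alpha> \<noteq> 0 \<or> \<beta> \<noteq> 0) \<and> \<alpha> * padeC 0 N x + \<beta> * padeC 1 N x = 0"
  proof (cases "padeC 1 N x = 0 \<and> padeC 0 N x = 0")
    case True
    thus ?thesis by (intro exI[of _ 1]) auto
  next
    case False
    thus ?thesis by (intro exI[of _ "padeC 1 N x"] exI[of _ "- padeC 0 N x"]) auto
  qed
  then obtain \<alpha> \<beta> where ab: "\<alpha> \<noteq> 0 \<or> \<beta> \<noteq> 0" "\<alpha> * padeC 0 N x + \<beta> * padeC 1 N x = 0" by blast
  have "\<alpha> * padeA 0 N x + \<beta> * padeA 1 N x = p * (\<alpha> * padeC 0 N x + \<beta> * padeC 1 N x)"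
    using A[of 0] A[of 1] by (simp add: algebra_simps)
  with ab show False using pade_independent[of x \<alpha> N \<beta>] assms by auto
qed

text \<open>Binomials are bounded by powers of 2, and the number m + 1 of terms by another
  \<open>2 ^ m\<close>. A crude exponential bound is enough, because its logarithm is later compared
  with N times a large height.\<close>

lemma norm_padeE_le:
  fixes u v :: complex
  assumes "norm u \<le> M" "norm v \<le> M"
  shows "norm (padeE m n l u v) \<le> 2 ^ (3 * m + 2 * n + l + 1) * M ^ m"
proof -
  have "0 \<le> M" using assms norm_ge_zero order_trans by blast
  have "norm (padeE m n l u v) \<le>
     (\<Sum>k\<le>m. norm (of_nat ((m + n + l + 1) choose (m - k)) * of_nat ((n + k) choose k) * u ^ (m - k) * v ^ k))"
    unfolding padeE_def by (rule norm_sum)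
  also have "\<dots> \<le> (\<Sum>k\<le>m. 2 ^ (m + n + l + 1) * 2 ^ (n + m) * M ^ (m - k) * M ^ k)"
  proof (intro sum_mono)
    fix k assume "k \<in> {..m}"
    hence k: "k \<le> m" by simp
    have "real ((m + n + l + 1) choose (m - k)) \<le> real (2 ^ (m + n + l + 1))"
      by (subst of_nat_le_iff, rule binomial_le_pow2)
    moreover have "real ((n + k) choose k) \<le> real (2 ^ (n + m))"
      using k binomial_le_pow2[of "n + k" k] power_increasing[of "n + k" "n + m" "2::nat"]
      by (subst of_nat_le_iff) linarith
    ultimately show "norm (of_nat ((m + n + l + 1) choose (m - k)) * of_nat ((n + k) choose k) * u ^ (m - k) * v ^ k)
       \<le> 2 ^ (m + n + l + 1) * 2 ^ (n + m) * M ^ (m - k) * M ^ k"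
      unfolding norm_mult norm_power norm_of_nat using assms \<open>0 \<le> M\<close>
      by (intro mult_mono power_mono) auto
  qed
  also have "\<dots> = real (Suc m) * (2 ^ (m + n + l + 1) * 2 ^ (n + m) * M ^ m)"
    by (simp add: mult.assoc flip: power_add)
  also have "\<dots> \<le> 2 ^ m * (2 ^ (m + n + l + 1) * 2 ^ (n + m) * M ^ m)"
  proof (intro mult_right_mono)
    have "Suc m \<le> 2 ^ m" using less_exp[of m] by linarith
    thus "real (Suc m) \<le> 2 ^ m" by (metis of_nat_le_iff of_nat_power of_nat_numeral)
  qed (use \<open>0 \<le> M\<close> in auto)
  also have "\<dots> = 2 ^ (3 * m + 2 * n + l + 1) * M ^ m"
    by (simp add: mult_ac flip: power_add)
  finally show ?thesis .
qed

text \<open>The exponents come from the worst case, \<open>padeB\<close> with e = 1, whose first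
  index is N + 1.\<close>

lemma norm_pade_le:
  fixes x :: complex
  assumes "1 \<le> M" "norm x \<le> M" "norm (1 - x) \<le> M" "e \<le> 1"
  shows "norm (padeA e N x) \<le> 2 ^ (6 * N + 4) * M ^ (N + 1)"
    and "norm (padeB e N x) \<le> 2 ^ (6 * N + 4) * M ^ (N + 1)"
    and "norm (padeC e N x) \<le> 2 ^ (6 * N + 4) * M ^ (N + 1)"
proof -
  have *: "(2::real) ^ i * M ^ j \<le> 2 ^ (6 * N + 4) * M ^ (N + 1)" if "i \<le> 6 * N + 4" "j \<le> N + 1" for i j
    using that assms(1) by (intro mult_mono power_increasing) auto
  have "norm (padeA e N x) \<le> M ^ e * (2 ^ (3 * N + 2 * (N + e) + N + 1) * M ^ N)"
    unfolding padeA_def norm_mult norm_power using assms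
    by (intro mult_mono power_mono norm_padeE_le) auto
  also have "\<dots> = 2 ^ (3 * N + 2 * (N + e) + N + 1) * M ^ (N + e)" by (simp add: power_add)
  also have "\<dots> \<le> 2 ^ (6 * N + 4) * M ^ (N + 1)" using assms by (intro *) auto
  finally show "norm (padeA e N x) \<le> 2 ^ (6 * N + 4) * M ^ (N + 1)" .
  have "norm (padeB e N x) \<le> 2 ^ (3 * (N + e) + 2 * N + N + 1) * M ^ (N + e)"
    unfolding padeB_def using assms by (intro norm_padeE_le) (auto simp: norm_minus_commute)
  also have "\<dots> \<le> 2 ^ (6 * N + 4) * M ^ (N + 1)" using assms by (intro *) auto
  finally show "norm (padeB e N x) \<le> 2 ^ (6 * N + 4) * M ^ (N + 1)" .
  have "norm (padeC e N x) \<le> 2 ^ (3 * N + 2 * (N + e) + N + 1) * M ^ N"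
    unfolding padeC_def using assms by (intro norm_padeE_le) auto
  also have "\<dots> \<le> 2 ^ (6 * N + 4) * M ^ (N + 1)" using assms by (intro *) auto
  finally show "norm (padeC e N x) \<le> 2 ^ (6 * N + 4) * M ^ (N + 1)" .
qed

section \<open>The unit equation\<close>

text \<open>What the unit equation needs from a ring of integers: embeddings, norms of at least 1,
  and Northcott finiteness. The maps \<open>\<sigma> t\<close> are constrained on R only, as the
  surrounding field may be much larger than the number field, and T is an index set so that
  embeddings may be listed with multiplicity.\<close>

locale archimedean_places =
  fixes R :: "'k::field_char_0 set" and T :: "'t set" and \<sigma> :: "'t \<Rightarrow> 'k \<Rightarrow> complex"
  assumes finite_T: "finite T"
    and one_R: "1 \<in> R"
    and add_R: "x \<in> R \<Longrightarrow> y \<in> R \<Longrightarrow> x + y \<in> R"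
    and uminus_R: "x \<in> R \<Longrightarrow> - x \<in> R"
    and mult_R: "x \<in> R \<Longrightarrow> y \<in> R \<Longrightarrow> x * y \<in> R"
    and hom_one: "t \<in> T \<Longrightarrow> \<sigma> t 1 = 1"
    and hom_add: "t \<in> T \<Longrightarrow> x \<in> R \<Longrightarrow> y \<in> R \<Longrightarrow> \<sigma> t (x + y) = \<sigma> t x + \<sigma> t y"
    and hom_mult: "t \<in> T \<Longrightarrow> x \<in> R \<Longrightarrow> y \<in> R \<Longrightarrow> \<sigma> t (x * y) = \<sigma> t x * \<sigma> t y"
    and norm_ge_1: "x \<in> R \<Longrightarrow> x \<noteq> 0 \<Longrightarrow> 1 \<le> (\<Prod>t\<in>T. norm (\<sigma> t x))"
    and northcott: "finite {x \<in> R. \<forall>t\<in>T. norm (\<sigma> t x) \<le> B}"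
begin

lemma zero_R: "0 \<in> R"
  using add_R[OF one_R uminus_R[OF one_R]] by simp

lemma diff_R: "x \<in> R \<Longrightarrow> y \<in> R \<Longrightarrow> x - y \<in> R"
  using add_R[OF _ uminus_R, of x y] by simp

lemma power_R: "x \<in> R \<Longrightarrow> x ^ n \<in> R"
  by (induction n) (auto intro: one_R mult_R)

lemma of_nat_R: "of_nat n \<in> R"
  by (induction n) (auto intro: one_R zero_R add_R)

lemma sum_R: "(\<And>i. i \<in> I \<Longrightarrow> g i \<in> R) \<Longrightarrow> (\<Sum>i\<in>I. g i) \<in> R"
  by (induction I rule: infinite_finite_induct) (auto intro: zero_R add_R)

lemmas R_closed = zero_R one_R add_R uminus_R mult_R diff_R power_R of_nat_R sum_R

context
  fixes t assumes t: "t \<in> T"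
begin

lemma hom_zero: "\<sigma> t 0 = 0"
  using hom_add[OF t zero_R zero_R] by simp

lemma hom_uminus: "x \<in> R \<Longrightarrow> \<sigma> t (- x) = - \<sigma> t x"
  using hom_add[OF t _ uminus_R, of x x] by (simp add: hom_zero eq_neg_iff_add_eq_0 add.commute)

lemma hom_diff: "x \<in> R \<Longrightarrow> y \<in> R \<Longrightarrow> \<sigma> t (x - y) = \<sigma> t x - \<sigma> t y"
  using hom_add[OF t _ uminus_R, of x y] by (simp add: hom_uminus)

lemma hom_power: "x \<in> R \<Longrightarrow> \<sigma> t (x ^ n) = \<sigma> t x ^ n"
  by (induction n) (auto simp: hom_one[OF t] hom_mult[OF t] power_R)

lemma hom_of_nat: "\<sigma> t (of_nat n) = of_nat n"
  by (induction n) (auto simp: hom_one[OF t] hom_zero hom_add[OF t] one_R of_nat_R)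

lemma hom_sum: "(\<And>i. i \<in> I \<Longrightarrow> g i \<in> R) \<Longrightarrow> \<sigma> t (\<Sum>i\<in>I. g i) = (\<Sum>i\<in>I. \<sigma> t (g i))"
  by (induction I rule: infinite_finite_induct) (auto simp: hom_zero hom_add[OF t] sum_R)

lemmas hom_simps = hom_zero hom_one[OF t] hom_add[OF t] hom_uminus hom_mult[OF t] hom_diff
  hom_power hom_of_nat

lemma hom_padeE:
  assumes "u \<in> R" "v \<in> R"
  shows "\<sigma> t (padeE m n l u v) = padeE m n l (\<sigma> t u) (\<sigma> t v)"
  unfolding padeE_def using assms
  by (subst hom_sum) (auto intro!: R_closed simp: hom_simps R_closed)

end

lemma padeE_R: "u \<in> R \<Longrightarrow> v \<in> R \<Longrightarrow> padeE m n l u v \<in> R"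
  unfolding padeE_def by (intro R_closed)

lemma pade_R:
  assumes "x \<in> R"
  shows "padeA e N x \<in> R" "padeB e N x \<in> R" "padeC e N x \<in> R"
  unfolding padeA_def padeB_def padeC_def using assms by (auto intro!: R_closed padeE_R)

lemma hom_pade:
  assumes "t \<in> T" "x \<in> R"
  shows "\<sigma> t (padeA e N x) = padeA e N (\<sigma> t x)" "\<sigma> t (padeB e N x) = padeB e N (\<sigma> t x)"
    "\<sigma> t (padeC e N x) = padeC e N (\<sigma> t x)"
  unfolding padeA_def padeB_def padeC_def using assms
  by (simp_all add: hom_simps hom_padeE R_closed padeE_R)

section \<open>Units, heights and logarithmic vectors\<close>

definition units :: "'k set" where
  "units = {x. x \<noteq> 0 \<and> x \<in> R \<and> inverse x \<in> R}"

lemma units_mult: "x \<in> units \<Longrightarrow> y \<in> units \<Longrightarrow> x * y \<in> units"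
  by (simp add: units_def mult_R)

lemma units_power: "x \<in> units \<Longrightarrow> x ^ n \<in> units"
  by (induction n) (simp_all add: units_mult, simp add: units_def one_R)

lemma units_inverse: "x \<in> units \<Longrightarrow> inverse x \<in> units"
  by (auto simp: units_def)

lemma hom_unit_nonzero: "t \<in> T \<Longrightarrow> x \<in> units \<Longrightarrow> \<sigma> t x \<noteq> 0"
  using hom_mult[of t x "inverse x"] hom_one[of t] unfolding units_def by force

lemma hom_inverse:
  assumes "t \<in> T" "x \<in> units"
  shows "\<sigma> t (inverse x) = inverse (\<sigma> t x)"
proof -
  have "\<sigma> t x * \<sigma> t (inverse x) = \<sigma> t (x * inverse x)"
    using assms by (intro hom_mult[symmetric]) (auto simp: units_def)
  also have "\<dots> = 1" using assms hom_one by (simp add: units_def)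
  finally show ?thesis by (rule inverse_unique[symmetric])
qed

text \<open>A unit and its inverse both have norm at least 1, so the two sums are nonnegative and
  opposite.\<close>

lemma units_log_sum:
  assumes "x \<in> units"
  shows "(\<Sum>t\<in>T. ln (norm (\<sigma> t x))) = 0"
proof -
  have nonneg: "0 \<le> (\<Sum>t\<in>T. ln (norm (\<sigma> t y)))" if "y \<in> units" for y
  proof -
    have "(\<Sum>t\<in>T. ln (norm (\<sigma> t y))) = ln (\<Prod>t\<in>T. norm (\<sigma> t y))"
      using that by (intro ln_prod[symmetric] finite_T) (simp add: hom_unit_nonzero)
    thus ?thesis using norm_ge_1[of y] that by (simp add: units_def)
  qed
  have "(\<Sum>t\<in>T. ln (norm (\<sigma> t (inverse x)))) = - (\<Sum>t\<in>T. ln (norm (\<sigma> t x)))"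
    using assms by (simp add: hom_inverse norm_inverse ln_inverse hom_unit_nonzero flip: sum_negf)
  thus ?thesis using nonneg[OF assms] nonneg[OF units_inverse[OF assms]] by simp
qed

text \<open>The maximum includes 1 - x, so that one quantity controls both unknowns of the unit
  equation.\<close>

definition local_height :: "'t \<Rightarrow> 'k \<Rightarrow> real" where
  "local_height t x = max 1 (max (norm (\<sigma> t x)) (norm (\<sigma> t (1 - x))))"

definition height :: "'k \<Rightarrow> real" where
  "height x = (\<Sum>t\<in>T. ln (local_height t x))"

lemma local_height_ge:
  "1 \<le> local_height t x" "norm (\<sigma> t x) \<le> local_height t x" "norm (\<sigma> t (1 - x)) \<le> local_height t x"
  by (auto simp: local_height_def)

lemma ln_local_height_le: "t \<in> T \<Longrightarrow> ln (local_height t x) \<le> height x"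
  unfolding height_def by (intro member_le_sum finite_T) (use local_height_ge in auto)

definition exceptional_units :: "'k set" where
  "exceptional_units = {x \<in> units. 1 - x \<in> units}"

text \<open>Upper bounds suffice: the logarithms of a unit sum to zero, so a very negative one would
  have to be balanced by large positive ones at the other places.\<close>

lemma abs_ln_unit_le:
  assumes "y \<in> units" "t \<in> T" and le: "\<And>t. t \<in> T \<Longrightarrow> norm (\<sigma> t y) \<le> local_height t x"
  shows "\<bar>ln (norm (\<sigma> t y))\<bar> \<le> height x"
proof -
  have ln_le: "ln (norm (\<sigma> t y)) \<le> ln (local_height t x)" if "t \<in> T" for t
    using le[OF that] hom_unit_nonzero[OF that assms(1)] local_height_ge(1)[of t x]
    by (subst ln_le_cancel_iff) auto
  have "ln (norm (\<sigma> t y)) = - (\<Sum>s\<in>T - {t}. ln (norm (\<sigma> s y)))"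
    using units_log_sum[OF assms(1)] unfolding sum.remove[OF finite_T assms(2)] by linarith
  also have "- \<dots> \<le> (\<Sum>s\<in>T - {t}. ln (local_height s x))"
    using ln_le by (auto intro!: sum_mono)
  also have "\<dots> \<le> height x" unfolding height_def
    using local_height_ge by (intro sum_mono2 finite_T) auto
  finally have "- ln (norm (\<sigma> t y)) \<le> height x" by simp
  moreover have "ln (norm (\<sigma> t y)) \<le> height x"
    using ln_le[OF assms(2)] ln_local_height_le[OF assms(2), of x] by linarith
  ultimately show ?thesis by linarith
qed

lemma finite_height_le: "finite {x \<in> exceptional_units. height x \<le> B}"
proof (rule finite_subset[OF _ northcott[of "exp B"]])
  show "{x \<in> exceptional_units. height x \<le> B} \<subseteq> {x \<in> R. \<forall>t\<in>T. norm (\<sigma> t x) \<le> exp B}"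
  proof safe
    fix x t assume x: "x \<in> exceptional_units" "height x \<le> B" and t: "t \<in> T"
    have "ln (local_height t x) \<le> B" using ln_local_height_le[OF t, of x] x by simp
    hence "exp (ln (local_height t x)) \<le> exp B" by simp
    moreover have "exp (ln (local_height t x)) = local_height t x"
      using local_height_ge(1)[of t x] by (intro exp_ln) linarith
    ultimately have "local_height t x \<le> exp B" by simp
    thus "norm (\<sigma> t x) \<le> exp B" using local_height_ge(2)[of t x] by linarith
  qed (auto simp: exceptional_units_def units_def)
qed

lemma norm_linear_combination_le:
  fixes a b p q :: complex
  assumes "norm a \<le> K" "norm b \<le> K" "norm p \<le> P" "norm q \<le> P"
  shows "norm (a * q - b * p) \<le> 2 * K * P"
proof -
  have "norm (a * q - b * p) \<le> norm (a * q) + norm (b * p)" by (rule norm_triangle_ineq4)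
  also have "\<dots> \<le> K * P + K * P" unfolding norm_mult using assms
    by (intro add_mono mult_mono) (auto intro: order_trans[OF norm_ge_zero])
  finally show ?thesis by simp
qed

text \<open>Put \<open>n = 2 N + 1\<close> and let \<open>M\<close> be the local height of \<open>x\<close> at some \<open>t\<close>. The determinant \<open>d\<close> of the
  Pade identity and of \<open>p x\<^sup>n + q (1 - x)\<^sup>n = 1\<close>, and also \<open>d x\<^sup>n\<close> and \<open>d (1 - x)\<^sup>n\<close>, are only of
  order \<open>M ^ (N + 1)\<close>, so \<open>d\<close> itself has order \<open>M ^ (- N)\<close>; but the norm of \<open>d\<close> is at least 1.\<close>

lemma height_inequality:
  fixes N :: nat
  assumes x: "x \<in> exceptional_units" and z: "z \<in> exceptional_units"
  defines "p \<equiv> z * inverse x ^ (2 * N + 1)" and "q \<equiv> (1 - z) * inverse (1 - x) ^ (2 * N + 1)"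
  shows "real N * height x \<le> card T * (6 * N + 5) +
    (\<Sum>t\<in>T. ln (max 1 (max (norm (\<sigma> t p)) (norm (\<sigma> t q)))))"
proof -
  let ?n = "2 * N + 1"
  let ?P = "\<lambda>t. max 1 (max (norm (\<sigma> t p)) (norm (\<sigma> t q)))"
  let ?M = "\<lambda>t. local_height t x"
  have xu: "x \<in> units" "1 - x \<in> units" "z \<in> units" "1 - z \<in> units"
    using x z by (auto simp: exceptional_units_def)
  have pq: "p \<in> units" "q \<in> units" unfolding p_def q_def
    by (intro units_mult units_power units_inverse xu)+
  have nz: "x \<noteq> 0" "1 - x \<noteq> 0" "p \<noteq> 0" "q \<noteq> 0" and R: "x \<in> R" "p \<in> R" "q \<in> R"
    using xu pq by (auto simp: units_def)
  \<comment> \<open>Unfolded, this is z + (1 - z) = 1. The coefficients p and q are of moderate size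
    when the logarithmic vectors of z and 1 - z are close to ?n times those of x and 1 - x.\<close>
  have eq: "p * x ^ ?n + q * (1 - x) ^ ?n = 1"
    unfolding p_def q_def using nz by (simp add: power_inverse field_simps del: power_Suc)
  obtain e where e: "e \<le> 1" and e_nz: "padeA e N x * q - padeB e N x * p \<noteq> 0"
    using pade_determinant_nonzero[OF eq] nz by auto
  define d where "d = padeA e N x * q - padeB e N x * p"
  have dR: "d \<in> R" unfolding d_def by (intro R_closed pade_R R)
  have d_nz: "d \<noteq> 0" using e_nz by (simp add: d_def)
  have d1: "d * x ^ ?n = padeC e N x * q - padeB e N x * 1"
    and d2: "d * (1 - x) ^ ?n = padeA e N x * 1 - padeC e N x * p"
    using pade_determinant[OF eq, of e] by (simp_all add: d_def mult_ac)
  have bound: "norm (\<sigma> t d) * ?M t ^ ?n \<le> 2 ^ (6 * N + 5) * ?M t ^ (N + 1) * ?P t" if t: "t \<in> T" for t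
  proof -
    define s where "s = \<sigma> t x"
    have s1: "\<sigma> t (1 - x) = 1 - s" using t R by (simp add: s_def hom_diff hom_one R_closed)
    define K where "K = 2 ^ (6 * N + 4) * ?M t ^ (N + 1)"
    have "norm s \<le> ?M t" "norm (1 - s) \<le> ?M t"
      using local_height_ge[of t x] unfolding s1 s_def[symmetric] by simp_all
    note le = norm_pade_le[OF local_height_ge(1)[of t x] this e, of N, folded K_def]
    have P: "norm (\<sigma> t p) \<le> ?P t" "norm (\<sigma> t q) \<le> ?P t" "norm (1::complex) \<le> ?P t" by auto
    have "\<sigma> t d = padeA e N s * \<sigma> t q - padeB e N s * \<sigma> t p"
      using t R by (simp add: d_def hom_simps R_closed pade_R hom_pade s_def)
    hence "norm (\<sigma> t d) \<le> 2 * K * ?P t" using le P by (simp add: norm_linear_combination_le)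
    moreover have "norm (\<sigma> t d) * norm (\<sigma> t x) ^ ?n \<le> 2 * K * ?P t"
    proof -
      have "\<sigma> t d * \<sigma> t x ^ ?n = \<sigma> t (d * x ^ ?n)" using t R dR by (simp add: hom_simps R_closed)
      also have "\<dots> = padeC e N s * \<sigma> t q - padeB e N s * 1"
        unfolding d1 using t R by (simp add: hom_simps R_closed pade_R hom_pade s_def)
      finally have "norm (\<sigma> t d * \<sigma> t x ^ ?n) \<le> 2 * K * ?P t"
        using norm_linear_combination_le[OF le(3) le(2) P(3) P(2)] by simp
      thus ?thesis by (simp add: norm_mult norm_power)
    qed
    moreover have "norm (\<sigma> t d) * norm (\<sigma> t (1 - x)) ^ ?n \<le> 2 * K * ?P t"
    proof -
      have "\<sigma> t d * \<sigma> t (1 - x) ^ ?n = \<sigma> t (d * (1 - x) ^ ?n)" using t R dR by (simp add: hom_simps R_closed)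
      also have "\<dots> = padeA e N s * 1 - padeC e N s * \<sigma> t p"
        unfolding d2 using t R by (simp add: hom_simps R_closed pade_R hom_pade s_def)
      finally have "norm (\<sigma> t d * \<sigma> t (1 - x) ^ ?n) \<le> 2 * K * ?P t"
        using norm_linear_combination_le[OF le(1) le(3) P(1) P(3)] by simp
      thus ?thesis by (simp add: norm_mult norm_power)
    qed
    \<comment> \<open>The local height is one of 1, |x| and |1 - x|, and each case is one of the
      three bounds just shown.\<close>
    ultimately have "norm (\<sigma> t d) * ?M t ^ ?n \<le> 2 * K * ?P t"
      unfolding local_height_def by (auto simp: max_def)
    moreover have "2 * K = 2 ^ (6 * N + 5) * ?M t ^ (N + 1)" by (simp add: K_def power_add)
    ultimately show ?thesis by simp
  qed
  have Mpos: "0 < ?M t" for t using local_height_ge(1)[of t x] by linarith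
  have d_hom: "\<sigma> t d \<noteq> 0" if "t \<in> T" for t
  proof
    assume "\<sigma> t d = 0"
    hence "(\<Prod>t\<in>T. norm (\<sigma> t d)) = 0" using that finite_T by (intro prod_zero) auto
    thus False using norm_ge_1[OF dR d_nz] by simp
  qed
  have log: "ln (norm (\<sigma> t d)) + ?n * ln (?M t) \<le> (6 * N + 5) + (N + 1) * ln (?M t) + ln (?P t)"
    if t: "t \<in> T" for t
  proof -
    have Ppos: "0 < ?P t" by (simp add: max_def)
    have "ln (norm (\<sigma> t d)) + ?n * ln (?M t) = ln (norm (\<sigma> t d) * ?M t ^ ?n)"
      using Mpos[of t] d_hom[OF t] by (simp add: ln_mult ln_realpow del: power_Suc)
    also have "\<dots> \<le> ln (2 ^ (6 * N + 5) * ?M t ^ (N + 1) * ?P t)"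
      using bound[OF t] Mpos[of t] d_hom[OF t] Ppos by (subst ln_le_cancel_iff) (auto intro!: mult_pos_pos)
    also have "\<dots> = (6 * N + 5) * ln 2 + (N + 1) * ln (?M t) + ln (?P t)"
      using Mpos[of t] Ppos by (simp add: ln_mult_pos ln_realpow del: power_Suc)
    also have "(6 * N + 5) * ln 2 \<le> real (6 * N + 5) * 1"
      using ln_2_less_1 by (intro mult_left_mono) auto
    finally show ?thesis by (simp only: mult_1_right add_le_cancel_right)
  qed
  have "0 \<le> ln (\<Prod>t\<in>T. norm (\<sigma> t d))" using norm_ge_1[OF dR d_nz] by simp
  also have "\<dots> = (\<Sum>t\<in>T. ln (norm (\<sigma> t d)))" using d_hom by (intro ln_prod finite_T) auto
  finally have "?n * height x \<le> (\<Sum>t\<in>T. ln (norm (\<sigma> t d)) + ?n * ln (?M t))"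
    unfolding height_def by (simp add: sum.distrib sum_distrib_left)
  also have "\<dots> \<le> (\<Sum>t\<in>T. (6 * N + 5) + (N + 1) * ln (?M t) + ln (?P t))"
    by (intro sum_mono log)
  also have "\<dots> = card T * (6 * N + 5) + (N + 1) * height x + (\<Sum>t\<in>T. ln (?P t))"
    unfolding height_def by (simp add: sum.distrib sum_distrib_left)
  \<comment> \<open>Of the 2 N + 1 copies of the height, N + 1 are used up by the size of the
    approximations and N remain.\<close>
  finally show ?thesis by (simp add: algebra_simps)
qed

text \<open>The direction of a solution: its logarithms divided by the height fill a bounded cube,
  which is cut into cells of side 1 / K. Restriction to T leaves finitely many possible
  values.\<close>

definition box :: "nat \<Rightarrow> 'k \<Rightarrow> 't \<Rightarrow> int \<times> int" where
  "box K x = (\<lambda>t\<in>T. (\<lfloor>K * (ln (norm (\<sigma> t x)) / height x)\<rfloor>, \<lfloor>K * (ln (norm (\<sigma> t (1 - x))) / height x)\<rfloor>))"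

lemma exceptional_units_abs_ln_le:
  assumes "x \<in> exceptional_units" "t \<in> T"
  shows "\<bar>ln (norm (\<sigma> t x))\<bar> \<le> height x" "\<bar>ln (norm (\<sigma> t (1 - x)))\<bar> \<le> height x"
  using assms local_height_ge by (auto intro!: abs_ln_unit_le simp: exceptional_units_def)

lemma floor_mult_bounds:
  assumes "\<bar>u\<bar> \<le> (h::real)" "0 < h"
  shows "\<lfloor>real K * (u / h)\<rfloor> \<in> {- int K..int K}"
proof -
  have "\<bar>u / h\<bar> \<le> 1" using assms by (simp add: abs_divide)
  define w where "w = real K * (u / h)"
  have "\<bar>w\<bar> \<le> real K * 1" unfolding w_def abs_mult using \<open>\<bar>u / h\<bar> \<le> 1\<close> by (intro mult_mono) auto
  hence "- real K \<le> w" "w \<le> real K" by (simp_all add: abs_le_iff)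
  thus ?thesis unfolding w_def[symmetric] by (auto simp: le_floor_iff floor_le_iff)
qed

lemma box_mem:
  assumes "x \<in> exceptional_units" "0 < height x"
  shows "box K x \<in> T \<rightarrow>\<^sub>E ({- int K..int K} \<times> {- int K..int K})"
  unfolding box_def using assms exceptional_units_abs_ln_le
  by (intro PiE_I) (auto simp del: atLeastAtMost_iff times_divide_eq_right intro!: floor_mult_bounds)

lemma floor_eq_imp_close:
  assumes "\<lfloor>real K * (u / h)\<rfloor> = \<lfloor>real K * (u' / h')\<rfloor>" "0 < h" "0 < h'" "0 < K"
  shows "\<bar>u' - (h' / h) * u\<bar> \<le> h' / K"
proof -
  have "\<bar>real K * (u / h) - real K * (u' / h')\<bar> \<le> 1" using assms(1) by linarith
  hence "\<bar>real K * (u / h) - real K * (u' / h')\<bar> * (h' / K) \<le> 1 * (h' / K)"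
    using assms by (intro mult_right_mono) auto
  moreover have "\<bar>real K * (u / h) - real K * (u' / h')\<bar> * (h' / K) =
     \<bar>(real K * (u / h) - real K * (u' / h')) * (h' / K)\<bar>" using assms by (simp add: abs_mult)
  moreover have "(real K * (u / h) - real K * (u' / h')) * (h' / K) = (h' / h) * u - u'"
    using assms by (simp add: field_simps)
  ultimately show ?thesis by linarith
qed

text \<open>A solution z of much larger height in the same cell resembles the power of x with
  exponent about h' / h. Then p and q in \<open>height_inequality\<close> contribute less than N
  times the height of x, unless N is bounded in terms of \<open>card T\<close>.\<close>

lemma same_box_heights:
  assumes x: "x \<in> exceptional_units" and z: "z \<in> exceptional_units"
    and box: "box (8 * (card T + 1)) x = box (8 * (card T + 1)) z"
    and hx: "24 * card T + 1 \<le> height x"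
  shows "height z < (8 * card T + 20) * height x"
proof (rule ccontr)
  assume neg: "\<not> ?thesis"
  define h where "h = height x"
  define h' where "h' = height z"
  define r where "r = h' / h"
  define K where "K = 8 * (card T + 1)"
  have h: "24 * card T + 1 \<le> h" "0 < h" using hx by (auto simp: h_def)
  have "(8 * card T + 20) * h \<le> h'" using neg by (simp add: h_def h'_def)
  hence r: "8 * card T + 20 \<le> r" using h by (simp add: r_def field_simps)
  have h': "h' = r * h" using h by (simp add: r_def)
  have h'_pos: "0 < h'" using r h by (simp add: h')
  \<comment> \<open>This makes 2 N + 1 the largest odd integer not above r, so that r - (2 N + 1)
    lies between 0 and 2.\<close>
  define N where "N = nat \<lfloor>(r - 1) / 2\<rfloor>"
  have N: "2 * real N + 1 \<le> r" "r \<le> 2 * real N + 3"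
  proof -
    have "0 \<le> (r - 1) / 2" using r by simp
    hence "real N = of_int \<lfloor>(r - 1) / 2\<rfloor>" by (simp add: N_def)
    moreover have "\<lfloor>(r - 1) / 2\<rfloor> \<le> (r - 1) / 2" "(r - 1) / 2 < \<lfloor>(r - 1) / 2\<rfloor> + 1"
      using floor_correct[of "(r - 1) / 2"] by simp_all
    ultimately have "real N \<le> (r - 1) / 2" "(r - 1) / 2 < real N + 1" by simp_all
    thus "2 * real N + 1 \<le> r" and "r \<le> 2 * real N + 3" by (auto simp: field_simps)
  qed
  define p where "p = z * inverse x ^ (2 * N + 1)"
  define q where "q = (1 - z) * inverse (1 - x) ^ (2 * N + 1)"
  have xu: "x \<in> units" "1 - x \<in> units" "z \<in> units" "1 - z \<in> units"
    using x z by (auto simp: exceptional_units_def)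
  have close: "ln (norm (\<sigma> t (Y * inverse y ^ (2 * N + 1)))) \<le> ((2 * N + 3) / K + 2) * h"
    if t: "t \<in> T" and y: "y \<in> units" "Y \<in> units" "\<bar>ln (norm (\<sigma> t y))\<bar> \<le> h"
      and fl: "\<lfloor>real K * (ln (norm (\<sigma> t y)) / h)\<rfloor> = \<lfloor>real K * (ln (norm (\<sigma> t Y)) / h')\<rfloor>" for t y Y
  proof -
    let ?u = "ln (norm (\<sigma> t y))" and ?U = "ln (norm (\<sigma> t Y))"
    have "inverse y ^ (2 * N + 1) \<in> R" "Y \<in> R" "inverse y \<in> R"
      using units_power[OF units_inverse[OF y(1)], of "2 * N + 1"] y by (auto simp: units_def)
    hence "\<sigma> t (Y * inverse y ^ (2 * N + 1)) = \<sigma> t Y * inverse (\<sigma> t y) ^ (2 * N + 1)"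
      using t y by (simp add: hom_simps hom_inverse R_closed)
    hence "ln (norm (\<sigma> t (Y * inverse y ^ (2 * N + 1)))) = ?U - (2 * N + 1) * ?u"
      using hom_unit_nonzero[OF t] y
      by (simp add: norm_mult norm_power norm_inverse ln_mult ln_realpow ln_inverse del: power_Suc)
    \<comment> \<open>The first part is small because both solutions share a cell; the second is the
      cost of rounding r to an odd integer.\<close>
    also have "\<dots> = (?U - r * ?u) + (r - (2 * N + 1)) * ?u" by (simp add: algebra_simps)
    also have "\<dots> \<le> h' / K + 2 * h"
    proof (rule add_mono)
      show "?U - r * ?u \<le> h' / K"
        using floor_eq_imp_close[OF fl h(2) h'_pos] by (simp add: r_def K_def)
      have "(r - (2 * N + 1)) * ?u \<le> \<bar>r - (2 * N + 1)\<bar> * \<bar>?u\<bar>" by (metis abs_ge_self abs_mult)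
      also have "\<dots> \<le> 2 * h" using N y(3) by (intro mult_mono) auto
      finally show "(r - (2 * N + 1)) * ?u \<le> 2 * h" .
    qed
    also have "h' / K \<le> (2 * N + 3) * h / K"
      unfolding h' using N h by (intro divide_right_mono mult_right_mono) auto
    finally show ?thesis by (simp add: algebra_simps)
  qed
  have box_eq: "\<lfloor>real K * (ln (norm (\<sigma> t x)) / h)\<rfloor> = \<lfloor>real K * (ln (norm (\<sigma> t z)) / h')\<rfloor>"
    "\<lfloor>real K * (ln (norm (\<sigma> t (1 - x))) / h)\<rfloor> = \<lfloor>real K * (ln (norm (\<sigma> t (1 - z))) / h')\<rfloor>"
    if t: "t \<in> T" for t
    using fun_cong[OF box, of t] t unfolding box_def K_def[symmetric] h_def[symmetric] h'_def[symmetric]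
    by simp_all
  have P: "ln (max 1 (max (norm (\<sigma> t p)) (norm (\<sigma> t q)))) \<le> ((2 * N + 3) / K + 2) * h" if t: "t \<in> T" for t
  proof -
    have "ln (norm (\<sigma> t p)) \<le> ((2 * N + 3) / K + 2) * h" unfolding p_def
      using exceptional_units_abs_ln_le[OF x t] box_eq[OF t] xu t by (intro close) (auto simp: h_def)
    moreover have "ln (norm (\<sigma> t q)) \<le> ((2 * N + 3) / K + 2) * h" unfolding q_def
      using exceptional_units_abs_ln_le[OF x t] box_eq[OF t] xu t by (intro close) (auto simp: h_def)
    moreover have "ln 1 \<le> ((2 * N + 3) / K + 2) * h" using h by simp
    ultimately show ?thesis by (auto simp: max_def)
  qed
  have "N * h \<le> card T * (6 * N + 5) + (\<Sum>t\<in>T. ln (max 1 (max (norm (\<sigma> t p)) (norm (\<sigma> t q)))))"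
    unfolding p_def q_def h_def by (rule height_inequality[OF x z])
  also have "\<dots> \<le> card T * (6 * N + 5) + (\<Sum>t\<in>T. ((2 * N + 3) / K + 2) * h)"
    by (intro add_left_mono sum_mono P)
  also have "\<dots> = card T * (6 * N + 5) + (card T * ((2 * N + 3) / K) + 2 * card T) * h"
    by (simp add: algebra_simps)
  \<comment> \<open>The threshold 24 card T + 1 on h absorbs the constants, and K = 8 (card T + 1)
    absorbs the width of the cells. Each costs about a quarter of N h.\<close>
  also have "\<dots> \<le> (N + 1) / 4 * h + ((2 * N + 3) / 8 + 2 * card T) * h"
  proof (intro add_mono mult_right_mono)
    have "card T * (6 * N + 5) \<le> (24 * card T + 1) * (real (N + 1) / 4)" by (simp add: field_simps)
    also have "\<dots> \<le> h * (real (N + 1) / 4)" using h by (intro mult_right_mono) auto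
    finally show "real (card T * (6 * N + 5)) \<le> (N + 1) / 4 * h" by (simp add: mult_ac)
    show "card T * ((2 * N + 3) / K) \<le> real (2 * N + 3) / 8"
      by (simp add: K_def field_simps)
  qed (use h in auto)
  finally have "N * h \<le> ((N + 1) / 4 + ((2 * N + 3) / 8 + 2 * card T)) * h" by (simp only: distrib_right)
  hence "N \<le> (N + 1) / 4 + ((2 * N + 3) / 8 + 2 * card T)" using h by simp
  \<comment> \<open>This is impossible: r is at least 8 card T + 20 and at most 2 N + 3, so N
    exceeds 4 card T + 8.\<close>
  hence "real N \<le> 4 * card T + 2" by (simp add: field_simps)
  thus False using N r by linarith
qed

text \<open>One of the finitely many cells would contain infinitely many solutions, and by Northcott
  their heights are unbounded. So it contains an x above the threshold and then a z far above
  x.\<close>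

theorem finite_exceptional_units: "finite exceptional_units"
proof (rule ccontr)
  assume inf: "infinite exceptional_units"
  have unbounded: "\<exists>x\<in>V. B < height x" if "infinite V" "V \<subseteq> exceptional_units" for V B
  proof (rule ccontr)
    assume "\<not> ?thesis"
    hence "V \<subseteq> {x \<in> exceptional_units. height x \<le> B}" using that by force
    thus False using finite_height_le finite_subset that by blast
  qed
  \<comment> \<open>Solutions of height 0 are set aside because \<open>box\<close> divides by the
    height.\<close>
  define W where "W = {x \<in> exceptional_units. 0 < height x}"
  define K where "K = 8 * (card T + 1)"
  have "exceptional_units = W \<union> {x \<in> exceptional_units. height x \<le> 0}" by (auto simp: W_def)
  hence "infinite W" using inf finite_height_le[of 0] by (metis finite_Un)
  moreover have "finite (box K ` W)"
    by (rule finite_subset[of _ "T \<rightarrow>\<^sub>E ({- int K..int K} \<times> {- int K..int K})"])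
       (use box_mem in \<open>auto simp: W_def intro!: finite_PiE finite_T\<close>)
  ultimately obtain a where a: "infinite {x \<in> W. box K x = box K a}"
    using pigeonhole_infinite by blast
  define V where "V = {x \<in> W. box K x = box K a}"
  have V: "infinite V" "V \<subseteq> exceptional_units" using a by (auto simp: V_def W_def)
  obtain x where x: "x \<in> V" "24 * card T + 1 < height x" using unbounded[OF V] by blast
  obtain z where z: "z \<in> V" "(8 * card T + 20) * height x < height z" using unbounded[OF V] by blast
  have "height z < (8 * card T + 20) * height x"
    using x z V by (intro same_box_heights) (auto simp: V_def K_def)
  with z show False by simp
qed

end

section \<open>Algebraic integers\<close>

definition int_span :: "'a::comm_ring_1 set \<Rightarrow> 'a set" where
  "int_span V = {x. \<exists>c. x = (\<Sum>w\<in>V. of_int (c w) * w)}"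

text \<open>The multipliers of the Z-module generated by V. They are closed under sums and products,
  so integrality of sums and products reduces to finding one V for both elements.\<close>

definition int_stabilizer :: "'a::comm_ring_1 set \<Rightarrow> 'a set" where
  "int_stabilizer V = {x. \<forall>v\<in>V. x * v \<in> int_span V}"

lemma int_span_base: "finite V \<Longrightarrow> v \<in> V \<Longrightarrow> v \<in> int_span V"
proof -
  assume V: "finite V" "v \<in> V"
  have "(\<Sum>w\<in>V. of_int (if w = v then 1 else 0) * w) = (\<Sum>w\<in>V. if w = v then w else 0)"
    by (intro sum.cong) auto
  also have "\<dots> = v" using V by simp
  finally show ?thesis unfolding int_span_def by (intro CollectI exI) (rule sym)
qed

lemma int_span_add: "x \<in> int_span V \<Longrightarrow> y \<in> int_span V \<Longrightarrow> x + y \<in> int_span V"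
proof -
  assume "x \<in> int_span V" "y \<in> int_span V"
  then obtain c d where "x = (\<Sum>w\<in>V. of_int (c w) * w)" "y = (\<Sum>w\<in>V. of_int (d w) * w)"
    by (auto simp: int_span_def)
  thus ?thesis unfolding int_span_def
    by (auto intro!: exI[of _ "\<lambda>w. c w + d w"] simp: sum.distrib distrib_right)
qed

lemma int_span_of_int_mult: "x \<in> int_span V \<Longrightarrow> of_int k * x \<in> int_span V"
proof -
  assume "x \<in> int_span V"
  then obtain c where "x = (\<Sum>w\<in>V. of_int (c w) * w)" by (auto simp: int_span_def)
  thus ?thesis unfolding int_span_def
    by (auto intro!: exI[of _ "\<lambda>w. k * c w"] simp: sum_distrib_left mult.assoc)
qed

lemma int_span_0: "0 \<in> int_span V"
  by (auto simp: int_span_def intro!: exI[of _ "\<lambda>_. 0"])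

lemma int_span_uminus: "x \<in> int_span V \<Longrightarrow> - x \<in> int_span V"
  using int_span_of_int_mult[of x V "-1"] by simp

lemma int_span_diff: "x \<in> int_span V \<Longrightarrow> y \<in> int_span V \<Longrightarrow> x - y \<in> int_span V"
  using int_span_add[of x V "- y"] int_span_uminus[of y V] by simp

lemma int_span_sum: "(\<And>i. i \<in> I \<Longrightarrow> f i \<in> int_span V) \<Longrightarrow> (\<Sum>i\<in>I. f i) \<in> int_span V"
  by (induction I rule: infinite_finite_induct) (auto intro: int_span_0 int_span_add)

lemma int_span_numeral_mult: "x \<in> int_span V \<Longrightarrow> numeral k * x \<in> int_span V"
  using int_span_of_int_mult[of x V "numeral k"] by simp

lemma int_stabilizer_mult_span:
  assumes "x \<in> int_stabilizer V" "y \<in> int_span V"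
  shows "x * y \<in> int_span V"
proof -
  obtain c where c: "y = (\<Sum>w\<in>V. of_int (c w) * w)" using assms(2) by (auto simp: int_span_def)
  have "x * y = (\<Sum>w\<in>V. of_int (c w) * (x * w))" by (simp add: c sum_distrib_left mult_ac)
  also have "\<dots> \<in> int_span V"
    using assms(1) by (intro int_span_sum int_span_of_int_mult) (auto simp: int_stabilizer_def)
  finally show ?thesis .
qed

lemma int_stabilizer_add: "x \<in> int_stabilizer V \<Longrightarrow> y \<in> int_stabilizer V \<Longrightarrow> x + y \<in> int_stabilizer V"
  by (auto simp: int_stabilizer_def distrib_right intro: int_span_add)

lemma int_stabilizer_mult: "x \<in> int_stabilizer V \<Longrightarrow> y \<in> int_stabilizer V \<Longrightarrow> x * y \<in> int_stabilizer V"
  using int_stabilizer_mult_span[of x V] by (auto simp: int_stabilizer_def mult.assoc)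

lemma int_stabilizer_power_mult_span:
  "x \<in> int_stabilizer V \<Longrightarrow> y \<in> int_span V \<Longrightarrow> x ^ n * y \<in> int_span V"
  by (induction n) (auto simp: mult.assoc intro: int_stabilizer_mult_span)

text \<open>The determinant trick: the elements of V form an eigenvector of an integer matrix with
  eigenvalue x, so x is a root of its monic characteristic polynomial. The element w keeps the
  eigenvector nonzero.\<close>

lemma int_stabilizer_imp_algebraic_int:
  fixes x :: "'a::field_char_0"
  assumes V: "finite V" "w \<in> V" "w \<noteq> 0" and x: "x \<in> int_stabilizer V"
  shows "algebraic_int x"
proof -
  define n where "n = card V"
  obtain e where e: "bij_betw e {0..<n} V" using ex_bij_betw_nat_finite[OF V(1)] n_def by blast
  have "\<exists>c. x * v = (\<Sum>w\<in>V. of_int (c w) * w)" if "v \<in> V" for v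
    using x that by (auto simp: int_stabilizer_def int_span_def)
  then obtain c where c: "x * v = (\<Sum>w\<in>V. of_int (c v w) * w)" if "v \<in> V" for v by metis
  define A where "A = mat n n (\<lambda>(i, j). c (e i) (e j))"
  define B where "B = map_mat (of_int :: int \<Rightarrow> 'a) A"
  have A: "A \<in> carrier_mat n n" by (simp add: A_def)
  have B: "B \<in> carrier_mat n n" by (simp add: B_def A_def)
  define u where "u = vec n e"
  have eV: "e i \<in> V" if "i < n" for i using e that by (auto simp: bij_betw_def)
  have "B *\<^sub>v u = x \<cdot>\<^sub>v u"
  proof (rule eq_vecI)
    fix i assume "i < dim_vec (x \<cdot>\<^sub>v u)"
    hence i: "i < n" by (simp add: u_def)
    have "(B *\<^sub>v u) $ i = (\<Sum>j\<in>{0..<n}. of_int (c (e i) (e j)) * e j)"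
      using i by (simp add: B_def A_def u_def scalar_prod_def)
    also have "\<dots> = (\<Sum>w\<in>V. of_int (c (e i) w) * w)" by (rule sum.reindex_bij_betw[OF e])
    also have "\<dots> = x * e i" using c[OF eV[OF i]] by simp
    finally show "(B *\<^sub>v u) $ i = (x \<cdot>\<^sub>v u) $ i" using i by (simp add: u_def)
  qed (use B in \<open>auto simp: u_def\<close>)
  moreover obtain i where "i < n" "e i = w" using e V(2) by (auto simp: bij_betw_def)
  hence "u $ i \<noteq> 0\<^sub>v n $ i" using V(3) by (simp add: u_def)
  hence "u \<noteq> 0\<^sub>v n" by metis
  moreover have "u \<in> carrier_vec n" by (simp add: u_def)
  ultimately have "eigenvalue B x" using B by (auto simp: eigenvalue_def eigenvector_def)
  hence "poly (char_poly B) x = 0" using eigenvalue_root_char_poly[OF B] by simp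
  moreover have "char_poly B = map_poly of_int (char_poly A)"
    unfolding B_def by (rule of_int_hom.char_poly_hom[OF A])
  ultimately have "poly (map_poly of_int (char_poly A)) x = 0" by simp
  moreover have "lead_coeff (char_poly A) = 1" using degree_monic_char_poly[OF A] by simp
  ultimately show ?thesis unfolding algebraic_int_altdef_ipoly by blast
qed

lemma algebraic_int_relation:
  assumes "algebraic_int (x :: 'a::field_char_0)"
  obtains n a where "n > 0" "x ^ n = (\<Sum>i<n. of_int (a i) * x ^ i)"
proof -
  obtain p where p: "poly (map_poly of_int p) x = 0" "lead_coeff p = 1"
    using assms unfolding algebraic_int_altdef_ipoly by blast
  define n where "n = Polynomial.degree p"
  have "(\<Sum>i\<le>n. of_int (Polynomial.coeff p i) * x ^ i) = 0"
    using p(1) by (simp add: poly_altdef n_def)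
  moreover have "{..n} = insert n {..<n}" by auto
  ultimately have "of_int (Polynomial.coeff p n) * x ^ n + (\<Sum>i<n. of_int (Polynomial.coeff p i) * x ^ i) = 0"
    by simp
  hence "x ^ n + (\<Sum>i<n. of_int (Polynomial.coeff p i) * x ^ i) = 0"
    unfolding n_def p(2) by simp
  hence eq: "x ^ n = (\<Sum>i<n. of_int (- Polynomial.coeff p i) * x ^ i)"
    by (simp only: of_int_minus mult_minus_left sum_negf eq_neg_iff_add_eq_0)
  have "n > 0"
  proof (rule ccontr)
    assume "\<not> n > 0"
    with eq show False by simp
  qed
  from that[OF this eq] show thesis .
qed

lemma algebraic_int_monic_relation:
  fixes x :: "'a::field_char_0"
  assumes "n > 0" "x ^ n = (\<Sum>i<n. of_int (a i) * x ^ i)"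
  shows "algebraic_int x"
proof -
  define p where "p = Polynomial.monom 1 n - (\<Sum>i<n. Polynomial.monom (a i) i)"
  have c: "Polynomial.coeff p k = (if k = n then 1 else 0) - (if k < n then a k else 0)" for k
    by (simp add: p_def coeff_sum)
  have "Polynomial.degree p = n"
    by (rule antisym) (auto intro!: degree_le le_degree simp: c)
  hence "Polynomial.lead_coeff p = 1" by (simp add: c)
  moreover have "poly (map_poly of_int p) x = 0"
    using assms(2)
    by (simp add: p_def of_int_poly_hom.hom_minus of_int_poly_hom.hom_sum poly_sum poly_monom)
  ultimately show ?thesis unfolding algebraic_int_altdef_ipoly by blast
qed

context
  fixes \<alpha> \<beta> :: "'a::field_char_0" and m n :: nat and a :: "nat \<Rightarrow> int" and V :: "'a set"
  assumes mn: "m > 0" "n > 0" and a: "\<alpha> ^ m = (\<Sum>i<m. of_int (a i) * \<alpha> ^ i)"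
  defines "V \<equiv> (\<lambda>(i, j). \<alpha> ^ i * \<beta> ^ j) ` ({..<m} \<times> {..<n})"
begin

lemma monomials_finite: "finite V"
  by (simp add: V_def)

lemma monomials_mem: "i < m \<Longrightarrow> j < n \<Longrightarrow> \<alpha> ^ i * \<beta> ^ j \<in> int_span V"
  by (rule int_span_base[OF monomials_finite]) (auto simp: V_def)

lemma monomials_power_mem: "j < n \<Longrightarrow> \<beta> ^ j \<in> int_span V"
  using monomials_mem[of 0 j] mn by simp

lemma monomials_stabilizer_left: "\<alpha> \<in> int_stabilizer V"
  unfolding int_stabilizer_def
proof (intro CollectI ballI)
  fix v assume "v \<in> V"
  then obtain i j where v: "v = \<alpha> ^ i * \<beta> ^ j" "i < m" "j < n" by (auto simp: V_def)
  show "\<alpha> * v \<in> int_span V"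
  proof (cases "Suc i < m")
    case True
    thus ?thesis using monomials_mem[of "Suc i" j] v by (simp add: mult.assoc)
  next
    case False
    hence "Suc i = m" using v by simp
    hence "\<alpha> * v = \<alpha> ^ m * \<beta> ^ j" using v by (auto simp: mult.assoc)
    also have "\<dots> = (\<Sum>k<m. of_int (a k) * (\<alpha> ^ k * \<beta> ^ j))"
      by (simp add: a sum_distrib_right mult.assoc)
    also have "\<dots> \<in> int_span V"
      using v by (intro int_span_sum int_span_of_int_mult monomials_mem) auto
    finally show ?thesis .
  qed
qed

text \<open>The hypothesis lets \<beta> be integral over Z[\<alpha>] only, which covers sums and
  products of algebraic integers as well as roots of monic polynomials over Z[\<alpha>].\<close>

lemma monomials_stabilizer_right:
  assumes "\<beta> ^ n \<in> int_span V"
  shows "\<beta> \<in> int_stabilizer V"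
  unfolding int_stabilizer_def
proof (intro CollectI ballI)
  fix v assume "v \<in> V"
  then obtain i j where v: "v = \<alpha> ^ i * \<beta> ^ j" "i < m" "j < n" by (auto simp: V_def)
  show "\<beta> * v \<in> int_span V"
  proof (cases "Suc j < n")
    case True
    thus ?thesis using monomials_mem[of i "Suc j"] v by (simp add: mult_ac)
  next
    case False
    hence "Suc j = n" using v by simp
    hence "\<beta> * v = \<alpha> ^ i * \<beta> ^ n" using v by (auto simp: mult_ac)
    thus ?thesis using int_stabilizer_power_mult_span[OF monomials_stabilizer_left assms] by simp
  qed
qed

lemma monomials_stabilizer_imp_algebraic_int: "x \<in> int_stabilizer V \<Longrightarrow> algebraic_int x"
  using mn by (intro int_stabilizer_imp_algebraic_int[OF monomials_finite, of 1]) (force simp: V_def)+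

end

lemma algebraic_int_add_mult:
  fixes x y :: "'a::field_char_0"
  assumes "algebraic_int x" "algebraic_int y"
  shows algebraic_int_add: "algebraic_int (x + y)" and algebraic_int_mult: "algebraic_int (x * y)"
proof -
  obtain m a where a: "m > 0" "x ^ m = (\<Sum>i<m. of_int (a i) * x ^ i)"
    using assms(1) by (rule algebraic_int_relation)
  obtain n b where b: "n > 0" "y ^ n = (\<Sum>i<n. of_int (b i) * y ^ i)"
    using assms(2) by (rule algebraic_int_relation)
  note mn = a(1) b(1) a(2)
  note x = monomials_stabilizer_left[OF mn, of y]
  have y: "y \<in> int_stabilizer ((\<lambda>(i, j). x ^ i * y ^ j) ` ({..<m} \<times> {..<n}))"
    by (rule monomials_stabilizer_right[OF mn], subst b(2))
       (intro int_span_sum int_span_of_int_mult monomials_power_mem[OF mn], auto)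
  show "algebraic_int (x + y)"
    by (rule monomials_stabilizer_imp_algebraic_int[OF mn, OF int_stabilizer_add[OF x y]])
  show "algebraic_int (x * y)"
    by (rule monomials_stabilizer_imp_algebraic_int[OF mn, OF int_stabilizer_mult[OF x y]])
qed

text \<open>Transitivity of integrality, with V the monomials in b and x. Only the products that
  occur in equations linear in b are exported.\<close>

lemma algebraic_int_over_adjunction:
  fixes b x :: "'a::field_char_0"
  assumes "algebraic_int b" "n > 0"
  obtains V where "\<And>j. j < n \<Longrightarrow> x ^ j \<in> int_span V" "\<And>j. j < n \<Longrightarrow> b * x ^ j \<in> int_span V"
    "x ^ n \<in> int_span V \<Longrightarrow> algebraic_int x"
proof -
  obtain m a where a: "m > 0" "b ^ m = (\<Sum>i<m. of_int (a i) * b ^ i)"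
    using assms(1) by (rule algebraic_int_relation)
  note mn = a(1) assms(2) a(2)
  show thesis
  proof (rule that)
    fix j assume j: "j < n"
    show "x ^ j \<in> int_span ((\<lambda>(i, j). b ^ i * x ^ j) ` ({..<m} \<times> {..<n}))"
      by (rule monomials_power_mem[OF mn j])
    thus "b * x ^ j \<in> int_span ((\<lambda>(i, j). b ^ i * x ^ j) ` ({..<m} \<times> {..<n}))"
      by (rule int_stabilizer_mult_span[OF monomials_stabilizer_left[OF mn]])
  next
    assume "x ^ n \<in> int_span ((\<lambda>(i, j). b ^ i * x ^ j) ` ({..<m} \<times> {..<n}))"
    thus "algebraic_int x"
      by (rule monomials_stabilizer_imp_algebraic_int[OF mn, OF monomials_stabilizer_right[OF mn]])
  qed
qed

lemma algebraic_int_sextic: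
  fixes b x :: "'a::field_char_0"
  assumes "algebraic_int b" and eq: "b * x\<^sup>2 * (1 - x)\<^sup>2 + (x\<^sup>2 - x + 1) ^ 3 = 0"
  shows "algebraic_int x"
proof -
  obtain V where V: "\<And>j. j < 6 \<Longrightarrow> x ^ j \<in> int_span V" "\<And>j. j < 6 \<Longrightarrow> b * x ^ j \<in> int_span V"
    "x ^ 6 \<in> int_span V \<Longrightarrow> algebraic_int x"
    using algebraic_int_over_adjunction[OF assms(1), of 6 x] by auto
  \<comment> \<open>The negated lower terms of the expanded sextic, each an integer multiple of
    \<open>x ^ j\<close> or \<open>b * x ^ j\<close> with j < 6.\<close>
  define r where "r = 3 * x ^ 5 - 6 * x ^ 4 + 7 * x ^ 3 - 6 * x ^ 2 + 3 * x ^ 1 - x ^ 0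
     - b * x ^ 4 + 2 * (b * x ^ 3) - b * x ^ 2"
  have "x ^ 6 - r = b * x\<^sup>2 * (1 - x)\<^sup>2 + (x\<^sup>2 - x + 1) ^ 3"
    by (simp add: r_def power2_eq_square power3_eq_cube algebra_simps eval_nat_numeral)
  hence "x ^ 6 = r" using eq by simp
  also have "r \<in> int_span V" unfolding r_def
    by (intro int_span_diff int_span_add int_span_numeral_mult V) auto
  finally show ?thesis by (rule V)
qed

lemma algebraic_int_cubic:
  fixes a x :: "'a::field_char_0"
  assumes "algebraic_int a" and eq: "x ^ 3 + a * x + a = 0"
  shows "algebraic_int x"
proof -
  obtain V where V: "\<And>j. j < 3 \<Longrightarrow> x ^ j \<in> int_span V" "\<And>j. j < 3 \<Longrightarrow> a * x ^ j \<in> int_span V"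
    "x ^ 3 \<in> int_span V \<Longrightarrow> algebraic_int x"
    using algebraic_int_over_adjunction[OF assms(1), of 3 x] by auto
  have "x ^ 3 = - (a * x ^ 1) - a * x ^ 0" using eq by (simp add: eq_neg_iff_add_eq_0 algebra_simps)
  also have "\<dots> \<in> int_span V" by (intro int_span_diff int_span_uminus V) auto
  finally show ?thesis by (rule V)
qed

section \<open>Conjugates and norms\<close>

definition rat_eval :: "'a::field_char_0 \<Rightarrow> rat poly \<Rightarrow> 'a" where
  "rat_eval x g = poly (map_poly of_rat g) x"

lemma map_poly_of_rat_mult:
  "map_poly of_rat (p * q) = map_poly of_rat p * (map_poly of_rat q :: 'a::field_char_0 poly)"
proof -
  interpret map_poly_comm_ring_hom "of_rat :: rat \<Rightarrow> 'a" ..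
  show ?thesis by (rule hom_mult)
qed

lemma map_poly_of_rat_diff:
  "map_poly of_rat (p - q) = map_poly of_rat p - (map_poly of_rat q :: 'a::field_char_0 poly)"
proof -
  interpret map_poly_comm_ring_hom "of_rat :: rat \<Rightarrow> 'a" ..
  show ?thesis by (rule hom_minus)
qed

lemma rat_eval_simps [simp]:
  fixes x :: "'a::field_char_0"
  shows "rat_eval x 0 = 0" "rat_eval x 1 = 1" "rat_eval x (p + q) = rat_eval x p + rat_eval x q"
    "rat_eval x (p * q) = rat_eval x p * rat_eval x q" "rat_eval x (p - q) = rat_eval x p - rat_eval x q"
    "rat_eval x [:c:] = of_rat c" "rat_eval x [:0, 1:] = x"
    "rat_eval x (Polynomial.smult c p) = of_rat c * rat_eval x p"
    "rat_eval x (p \<circ>\<^sub>p q) = rat_eval (rat_eval x q) p"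
proof -
  show "rat_eval x (p * q) = rat_eval x p * rat_eval x q"
    by (simp add: rat_eval_def map_poly_of_rat_mult)
  show "rat_eval x (p - q) = rat_eval x p - rat_eval x q"
    by (simp add: rat_eval_def map_poly_of_rat_diff)
  show "rat_eval x (p \<circ>\<^sub>p q) = rat_eval (rat_eval x q) p"
    by (simp add: rat_eval_def of_rat_hom.map_poly_pcompose poly_pcompose)
qed (simp_all add: rat_eval_def of_rat_hom.map_poly_hom_add of_rat_hom.map_poly_hom_smult
    of_rat_hom.map_poly_pCons_hom)

lemma rat_eval_minus [simp]: "rat_eval x (- p) = - rat_eval x p"
  using rat_eval_simps(5)[of x 0 p] by simp

lemma poly_of_int_eq_rat_eval:
  "poly (map_poly of_int q) x = rat_eval x (map_poly of_int q)"
  by (simp add: rat_eval_def map_poly_map_poly o_def)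

text \<open>Minimality of the degree stands in for irreducibility, and the leading coefficient is
  left free.\<close>

definition is_min_poly :: "'a::field_char_0 \<Rightarrow> rat poly \<Rightarrow> bool" where
  "is_min_poly x p \<longleftrightarrow> p \<noteq> 0 \<and> rat_eval x p = 0 \<and>
     (\<forall>q. q \<noteq> 0 \<longrightarrow> rat_eval x q = 0 \<longrightarrow> Polynomial.degree p \<le> Polynomial.degree q)"

lemma ex_min_poly:
  assumes "algebraic (x :: 'a::field_char_0)"
  shows "\<exists>p. is_min_poly x p"
proof -
  obtain q where "\<forall>i. Polynomial.coeff q i \<in> \<rat>" "q \<noteq> 0" "poly q x = 0"
    using assms unfolding algebraic_altdef by blast
  moreover from this obtain q' where "q = map_poly of_rat q'" by (metis ratpolyE)
  ultimately have "q' \<noteq> 0 \<and> rat_eval x q' = 0" by (auto simp: rat_eval_def)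
  from ex_has_least_nat[of "\<lambda>q. q \<noteq> 0 \<and> rat_eval x q = 0", OF this, of Polynomial.degree]
  show ?thesis unfolding is_min_poly_def by blast
qed

lemma min_poly_dvd:
  assumes "is_min_poly x p" "rat_eval x g = 0"
  shows "p dvd g"
proof (rule ccontr)
  assume "\<not> p dvd g"
  hence nz: "g mod p \<noteq> 0" by (simp add: dvd_eq_mod_eq_0)
  define u r where "u = g div p" and "r = g mod p"
  have "g = u * p + r" by (simp add: u_def r_def)
  hence "rat_eval x r = 0" using assms by (simp add: is_min_poly_def)
  hence "rat_eval x (g mod p) = 0" by (simp add: r_def)
  hence "Polynomial.degree p \<le> Polynomial.degree (g mod p)" using assms(1) nz by (simp add: is_min_poly_def)
  moreover have "Polynomial.degree (g mod p) < Polynomial.degree p"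
    using assms(1) nz degree_mod_less'[of p g] by (auto simp: is_min_poly_def)
  ultimately show False by simp
qed

lemma min_poly_root:
  assumes "is_min_poly x p" "rat_eval x g = 0" "rat_eval t p = 0"
  shows "rat_eval t g = 0"
  using min_poly_dvd[OF assms(1,2)] assms(3) by (auto elim!: dvdE)

text \<open>The gcd of p and g does not vanish at x, so its cofactor in p does. Minimality of the
  degree of p then makes the gcd constant.\<close>

lemma min_poly_bezout:
  assumes p: "is_min_poly x p" and g: "rat_eval x g \<noteq> 0"
  obtains a b where "a * p + b * g = 1"
proof -
  define d where "d = gcd p g"
  have "d dvd p" "d dvd g" by (simp_all add: d_def)
  then obtain e f where e: "p = d * e" and f: "g = d * f" by (auto elim!: dvdE)
  have p0: "p \<noteq> 0" "rat_eval x p = 0" using p by (auto simp: is_min_poly_def)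
  have "rat_eval x d \<noteq> 0" using g by (auto simp: f)
  hence "rat_eval x e = 0" using p0(2) by (simp add: e)
  moreover have de: "d \<noteq> 0" "e \<noteq> 0" using p0(1) by (auto simp: e)
  ultimately have "Polynomial.degree p \<le> Polynomial.degree e" using p by (simp add: is_min_poly_def)
  hence "Polynomial.degree d = 0" unfolding e using de by (simp add: degree_mult_eq)
  hence "is_unit d" using de by (simp add: is_unit_iff_degree)
  hence "d = 1" unfolding d_def by (simp only: is_unit_gcd_iff)
  thus thesis using that[of "fst (bezout_coefficients p g)" "snd (bezout_coefficients p g)"]
    by (simp add: bezout_coefficients_fst_snd d_def)
qed

text \<open>By Bezout, g cannot vanish at a conjugate without vanishing at x. This carries equations
  from the complex numbers back to the field.\<close>

lemma min_poly_common_root: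
  assumes "is_min_poly x p" "rat_eval t p = 0" "rat_eval t g = 0"
  shows "rat_eval x g = 0"
proof (rule ccontr)
  assume "rat_eval x g \<noteq> 0"
  then obtain a b where "a * p + b * g = 1" using min_poly_bezout[OF assms(1)] by blast
  hence "rat_eval t (a * p + b * g) = 1" by simp
  thus False using assms by simp
qed

section \<open>Symmetric functions of complex roots\<close>

abbreviation complex_roots :: "rat poly \<Rightarrow> complex multiset" where
  "complex_roots p \<equiv> proots (map_poly of_rat p)"

lemma poly_map_poly_of_rat [simp]: "poly (map_poly of_rat p) x = rat_eval x p"
  by (simp add: rat_eval_def)

lemma complex_roots_iff: "p \<noteq> 0 \<Longrightarrow> t \<in># complex_roots p \<longleftrightarrow> rat_eval t p = 0"
  by simp

lemma rat_eval_complex_factorization: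
  "rat_eval s p = of_rat (Polynomial.lead_coeff p) * (\<Prod>t\<in>#complex_roots p. s - t)"
proof -
  have "rat_eval s p = poly (Polynomial.smult (Polynomial.lead_coeff (map_poly of_rat p))
     (\<Prod>t\<in>#complex_roots p. [:- t, 1:])) s"
    by (subst complex_poly_decompose_multiset) simp
  also have "\<dots> = of_rat (Polynomial.lead_coeff p) * (\<Prod>t\<in>#complex_roots p. s - t)"
    by (simp add: poly_prod_mset image_mset.compositionality o_def)
  finally show ?thesis .
qed

text \<open>The product is, up to a power of the leading coefficient, the resultant of \<open>p\<close> and \<open>g\<close>; the
  induction is the Euclidean algorithm for resultants.\<close>

lemma prod_roots_rational: "(\<Prod>t\<in>#complex_roots p. rat_eval t g) \<in> \<rat>"
proof (induction "Polynomial.degree p" arbitrary: p g rule: less_induct)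
  case less
  show ?case
  proof (cases "p = 0")
    case False
    define h where "h = g mod p"
    have eq: "rat_eval t g = rat_eval t h" if "t \<in># complex_roots p" for t
    proof -
      define u where "u = g div p"
      have "g = u * p + h" by (simp add: u_def h_def)
      thus ?thesis using that False by simp
    qed
    hence gh: "(\<Prod>t\<in>#complex_roots p. rat_eval t g) = (\<Prod>t\<in>#complex_roots p. rat_eval t h)"
      by (intro arg_cong[of _ _ prod_mset] image_mset_cong)
    show ?thesis
    proof (cases "h = 0")
      case True
      thus ?thesis unfolding gh by simp
    next
      case h: False
      have deg: "Polynomial.degree h < Polynomial.degree p"
        using degree_mod_less'[of p g] False h unfolding h_def by blast
      have swap: "(\<Prod>t\<in>#complex_roots p. s - t) = rat_eval s p / of_rat (Polynomial.lead_coeff p)" for s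
        using False by (simp add: rat_eval_complex_factorization[of s p])
      have "(\<Prod>t\<in>#complex_roots p. rat_eval t h) =
         of_rat (Polynomial.lead_coeff h) ^ size (complex_roots p) *
           (\<Prod>s\<in>#complex_roots h. \<Prod>t\<in>#complex_roots p. t - s)"
        by (subst rat_eval_complex_factorization, subst prod_mset.distrib, subst prod_mset.swap) simp
      also have "(\<lambda>s. \<Prod>t\<in>#complex_roots p. t - s) =
         (\<lambda>s. (-1) ^ size (complex_roots p) * (rat_eval s p / of_rat (Polynomial.lead_coeff p)))"
      proof
        fix s
        have "(\<Prod>t\<in>#complex_roots p. t - s) = (\<Prod>t\<in>#complex_roots p. (-1) * (s - t))" by simp
        also have "\<dots> = (-1) ^ size (complex_roots p) * (\<Prod>t\<in>#complex_roots p. s - t)"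
          by (subst prod_mset.distrib) (simp only: prod_mset_constant)
        finally show "(\<Prod>t\<in>#complex_roots p. t - s) =
          (-1) ^ size (complex_roots p) * (rat_eval s p / of_rat (Polynomial.lead_coeff p))"
          by (simp only: swap)
      qed
      also have "(\<Prod>s\<in>#complex_roots h. (-1) ^ size (complex_roots p) *
          (rat_eval s p / of_rat (Polynomial.lead_coeff p))) =
        ((-1) ^ size (complex_roots p) / of_rat (Polynomial.lead_coeff p)) ^ size (complex_roots h) *
          (\<Prod>s\<in>#complex_roots h. rat_eval s p)"
        by (subst prod_mset_constant[symmetric], subst prod_mset.distrib[symmetric]) (simp add: field_simps)
      finally have "(\<Prod>t\<in>#complex_roots p. rat_eval t h) =
        of_rat (Polynomial.lead_coeff h) ^ size (complex_roots p) *
        (((-1) ^ size (complex_roots p) / of_rat (Polynomial.lead_coeff p)) ^ size (complex_roots h) *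
          (\<Prod>s\<in>#complex_roots h. rat_eval s p))" .
      moreover have "(\<Prod>s\<in>#complex_roots h. rat_eval s p) \<in> \<rat>" by (rule less(1)[OF deg])
      ultimately show ?thesis unfolding gh by (auto intro!: Rats_mult Rats_power Rats_divide)
    qed
  qed simp
qed

text \<open>Dividing by X - k splits off the value at k and leaves a quotient of smaller degree with
  rational values beyond k. Together with \<open>prod_roots_rational\<close> this replaces the
  theorem on symmetric functions.\<close>

lemma coeff_rational_if_values_rational:
  fixes f :: "'a::field_char_0 poly"
  assumes "\<And>n. n \<ge> k \<Longrightarrow> poly f (of_nat n) \<in> \<rat>"
  shows "Polynomial.coeff f i \<in> \<rat>"
  using assms
proof (induction "Polynomial.degree f" arbitrary: f k i rule: less_induct)
  case less
  define g where "g = synthetic_div f (of_nat k)"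
  have f: "f = [:- of_nat k, 1:] * g + [:poly f (of_nat k):]"
    unfolding g_def by (rule synthetic_div_correct'[symmetric])
  show ?case
  proof (cases "Polynomial.degree f = 0")
    case True
    then obtain c where "f = [:c:]" using degree_eq_zeroE by blast
    thus ?thesis using less(2)[of k] by (cases i) auto
  next
    case False
    have "poly g (of_nat n) \<in> \<rat>" if "n \<ge> Suc k" for n
    proof -
      have "poly f (of_nat n) = (of_nat n - of_nat k) * poly g (of_nat n) + poly f (of_nat k)"
        by (subst f) (simp add: algebra_simps)
      moreover have "(of_nat n :: 'a) - of_nat k \<noteq> 0" using that by simp
      ultimately have "poly g (of_nat n) = (poly f (of_nat n) - poly f (of_nat k)) / (of_nat n - of_nat k)"
        by (simp add: field_simps)
      thus ?thesis using less(2)[of n] less(2)[of k] that by auto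
    qed
    moreover have "Polynomial.degree g < Polynomial.degree f"
      using False by (simp add: g_def degree_synthetic_div)
    ultimately have g: "Polynomial.coeff g i \<in> \<rat>" for i using less(1) by blast
    show ?thesis
      by (subst f) (cases i, auto intro!: Rats_add Rats_diff Rats_mult g less(2) simp: coeff_pCons split: nat.splits)
  qed
qed

lemma algebraic_int_coeff_prod_linear:
  fixes A :: "'a::field_char_0 multiset"
  assumes "\<And>a. a \<in># A \<Longrightarrow> algebraic_int a"
  shows "algebraic_int (Polynomial.coeff (\<Prod>a\<in>#A. [:- a, 1:]) i)"
  using assms
proof (induction A arbitrary: i)
  case empty
  thus ?case by (cases i) (auto simp: coeff_pCons split: nat.splits)
next
  case (add a A)
  define q where "q = (\<Prod>a\<in>#A. [:- a, 1:])"
  have q: "algebraic_int (Polynomial.coeff q i)" for i unfolding q_def using add by auto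
  have "(\<Prod>a\<in>#add_mset a A. [:- a, 1:]) = Polynomial.smult (- a) q + pCons 0 q" by (simp add: q_def)
  hence "Polynomial.coeff (\<Prod>a\<in>#add_mset a A. [:- a, 1:]) i =
     - a * Polynomial.coeff q i + Polynomial.coeff (pCons 0 q) i" by (simp only: coeff_add coeff_smult)
  moreover have "algebraic_int (Polynomial.coeff (pCons 0 q) i)" using q by (cases i) auto
  moreover have "algebraic_int (- a)" using add(2)[of a] by simp
  ultimately show ?case by (simp only: algebraic_int_add algebraic_int_mult q)
qed

text \<open>The coefficients are dominated by those of a power of X + B, which sum to the
  bound.\<close>

lemma norm_coeff_prod_linear_le:
  fixes A :: "complex multiset"
  assumes "\<And>a. a \<in># A \<Longrightarrow> norm a \<le> B" "0 \<le> B"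
  shows "norm (Polynomial.coeff (\<Prod>a\<in>#A. [:- a, 1:]) i) \<le> (B + 1) ^ size A"
  using assms
proof (induction A arbitrary: i)
  case empty
  thus ?case by (cases i) auto
next
  case (add a A)
  define q where "q = (\<Prod>a\<in>#A. [:- a, 1:])"
  have q: "norm (Polynomial.coeff q i) \<le> (B + 1) ^ size A" for i unfolding q_def using add by auto
  have "(\<Prod>a\<in>#add_mset a A. [:- a, 1:]) = Polynomial.smult (- a) q + pCons 0 q" by (simp add: q_def)
  hence "norm (Polynomial.coeff (\<Prod>a\<in>#add_mset a A. [:- a, 1:]) i) \<le>
     norm (- a * Polynomial.coeff q i) + norm (Polynomial.coeff (pCons 0 q) i)"
    by (simp only: coeff_add coeff_smult norm_triangle_ineq)
  also have "\<dots> \<le> B * (B + 1) ^ size A + (B + 1) ^ size A"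
  proof (rule add_mono)
    show "norm (- a * Polynomial.coeff q i) \<le> B * (B + 1) ^ size A"
      unfolding norm_mult using add(2)[of a] add(3) q by (intro mult_mono) auto
    show "norm (Polynomial.coeff (pCons 0 q) i) \<le> (B + 1) ^ size A"
      using q add(3) by (cases i) auto
  qed
  finally show ?case by (simp add: algebra_simps)
qed

lemma finite_int_polys_bounded:
  "finite {f :: int poly. Polynomial.degree f \<le> d \<and> (\<forall>i. \<bar>Polynomial.coeff f i\<bar> \<le> C)}"
proof (rule finite_subset)
  show "{f :: int poly. Polynomial.degree f \<le> d \<and> (\<forall>i. \<bar>Polynomial.coeff f i\<bar> \<le> C)} \<subseteq>
    Poly ` {xs. set xs \<subseteq> {-C..C} \<and> length xs \<le> Suc d}"
  proof
    fix f :: "int poly"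
    assume "f \<in> {f. Polynomial.degree f \<le> d \<and> (\<forall>i. \<bar>Polynomial.coeff f i\<bar> \<le> C)}"
    hence f: "Polynomial.degree f \<le> d" "\<And>i. \<bar>Polynomial.coeff f i\<bar> \<le> C" by auto
    have "set (coeffs f) \<subseteq> {-C..C}"
    proof
      fix c assume "c \<in> set (coeffs f)"
      then obtain i where "c = Polynomial.coeff f i" by (auto simp: coeffs_def split: if_splits)
      thus "c \<in> {-C..C}" using f(2)[of i] by (simp add: abs_le_iff)
    qed
    moreover have "length (coeffs f) \<le> Suc d" using f(1) by (cases "f = 0") (auto simp: length_coeffs_degree)
    ultimately show "f \<in> Poly ` {xs. set xs \<subseteq> {-C..C} \<and> length xs \<le> Suc d}"
      by (intro image_eqI[of _ _ "coeffs f"]) auto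
  qed
  show "finite (Poly ` {xs. set xs \<subseteq> {-C..C} \<and> length xs \<le> Suc d})"
    by (intro finite_imageI finite_lists_length_le) simp
qed

text \<open>The embedding of Q(\<theta>) that sends \<theta> to t, computed from a chosen
  representative. It is independent of the choice when t is a root of the minimal polynomial of
  \<theta>; outside Q(\<theta>) its values are arbitrary.\<close>

definition conjugate :: "'a::field_char_0 \<Rightarrow> complex \<Rightarrow> 'a \<Rightarrow> complex" where
  "conjugate \<theta> t x = rat_eval t (SOME g. rat_eval \<theta> g = x)"

lemma conjugate_rat_eval:
  assumes "is_min_poly \<theta> p" "rat_eval t p = 0"
  shows "conjugate \<theta> t (rat_eval \<theta> g) = rat_eval t g"
proof -
  define h where "h = (SOME h. rat_eval \<theta> h = rat_eval \<theta> g)"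
  have "rat_eval \<theta> h = rat_eval \<theta> g" unfolding h_def by (rule someI) simp
  hence "rat_eval \<theta> (h - g) = 0" by simp
  hence "rat_eval t (h - g) = 0" using min_poly_root[OF assms(1) _ assms(2)] by blast
  thus ?thesis by (simp add: conjugate_def h_def)
qed

text \<open>An integer equation for g(\<theta>) is a rational equation for \<theta>, so it also
  holds at t.\<close>

lemma algebraic_int_conjugate:
  assumes "is_min_poly \<theta> p" "rat_eval t p = 0" "algebraic_int (rat_eval \<theta> g)"
  shows "algebraic_int (rat_eval t g)"
proof -
  obtain q where q: "poly (map_poly of_int q) (rat_eval \<theta> g) = 0" "Polynomial.lead_coeff q = 1"
    using assms(3) unfolding algebraic_int_altdef_ipoly by blast
  have "rat_eval \<theta> (map_poly of_int q \<circ>\<^sub>p g) = 0" using q(1) by (simp add: poly_of_int_eq_rat_eval)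
  hence "rat_eval t (map_poly of_int q \<circ>\<^sub>p g) = 0" by (rule min_poly_root[OF assms(1) _ assms(2)])
  thus ?thesis using q(2) unfolding algebraic_int_altdef_ipoly by (auto simp: poly_of_int_eq_rat_eval)
qed

text \<open>The values at natural numbers n are products of n - g(t) over the roots, so the
  coefficients are rational. They are also algebraic integers, hence integers.\<close>

lemma conjugates_char_poly:
  assumes p: "is_min_poly \<theta> p" and g: "algebraic_int (rat_eval \<theta> g)"
  obtains f :: "int poly"
    where "map_poly of_int f = (\<Prod>t\<in>#complex_roots p. [:- rat_eval t g, 1:])"
proof -
  define f where "f = (\<Prod>t\<in>#complex_roots p. [:- rat_eval t g, 1:])"
  have p0: "p \<noteq> 0" using p by (simp add: is_min_poly_def)
  have f': "f = (\<Prod>a\<in>#image_mset (\<lambda>t. rat_eval t g) (complex_roots p). [:- a, 1:])"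
    by (simp add: f_def image_mset.compositionality o_def)
  have "poly f (of_nat n) = (\<Prod>t\<in>#complex_roots p. rat_eval t ([:of_nat n:] - g))" for n
    by (simp add: f_def poly_prod_mset image_mset.compositionality o_def)
  hence "poly f (of_nat n) \<in> \<rat>" for n by (simp only: prod_roots_rational)
  hence rat: "Polynomial.coeff f i \<in> \<rat>" for i by (rule coeff_rational_if_values_rational)
  have "algebraic_int (Polynomial.coeff f i)" for i
    unfolding f' using p0
    by (intro algebraic_int_coeff_prod_linear)
       (auto simp: complex_roots_iff intro: algebraic_int_conjugate[OF p _ g])
  hence "Polynomial.coeff f i \<in> \<int>" for i using rational_algebraic_int_is_int rat by blast
  then obtain q where "f = map_poly of_int q" by (elim intpolyE) blast+
  thus thesis using that by (simp add: f_def)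
qed

text \<open>Listing the roots turns products over a multiset into products over positions, which
  serve as the index set of the places.\<close>

locale simple_extension =
  fixes \<theta> :: "'k::field_char_0" and p :: "rat poly" and ts :: "complex list"
  assumes min_poly: "is_min_poly \<theta> p" and ts: "mset ts = complex_roots p"
begin

definition integers :: "'k set" where
  "integers = {x. algebraic_int x \<and> x \<in> range (rat_eval \<theta>)}"

lemma p_nonzero: "p \<noteq> 0"
  using min_poly by (simp add: is_min_poly_def)

lemma nth_root: "i < length ts \<Longrightarrow> rat_eval (ts ! i) p = 0"
  using complex_roots_iff[OF p_nonzero, of "ts ! i"] by (simp flip: ts)

lemma ts_nonempty: "ts \<noteq> []"
proof
  assume "ts = []"
  hence "size (complex_roots p) = 0" by (simp flip: ts)
  hence "Polynomial.degree p = 0" by (simp add: size_proots_complex)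
  then obtain c where "p = [:c:]" using degree_eq_zeroE by blast
  thus False using min_poly by (simp add: is_min_poly_def)
qed

lemma conjugate_nth: "i < length ts \<Longrightarrow> conjugate \<theta> (ts ! i) (rat_eval \<theta> g) = rat_eval (ts ! i) g"
  by (rule conjugate_rat_eval[OF min_poly nth_root])

lemma prod_conjugates:
  "(\<Prod>i<length ts. norm (conjugate \<theta> (ts ! i) (rat_eval \<theta> g))) = norm (\<Prod>t\<in>#complex_roots p. rat_eval t g)"
proof -
  have "(\<Prod>t\<in>#complex_roots p. rat_eval t g) = prod_list (map (\<lambda>t. rat_eval t g) ts)"
    by (simp only: ts[symmetric] prod_mset_prod_list flip: mset_map)
  also have "\<dots> = (\<Prod>i<length ts. rat_eval (ts ! i) g)"
    by (simp add: prod.list_conv_set_nth atLeast0LessThan)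
  also have "norm \<dots> = (\<Prod>i<length ts. norm (rat_eval (ts ! i) g))" by (rule prod_norm[symmetric])
  finally show ?thesis by (simp add: conjugate_nth)
qed

text \<open>The product of the conjugates is a rational algebraic integer, hence an integer, and a
  vanishing conjugate would force x = 0.\<close>

lemma norm_ge_1:
  assumes "x \<in> integers" "x \<noteq> 0"
  shows "1 \<le> (\<Prod>i<length ts. norm (conjugate \<theta> (ts ! i) x))"
proof -
  obtain g where g: "x = rat_eval \<theta> g" using assms(1) by (auto simp: integers_def)
  define c where "c = (\<Prod>t\<in>#complex_roots p. rat_eval t g)"
  have *: "algebraic_int (prod_mset A)" if "\<And>a. a \<in># A \<Longrightarrow> algebraic_int a" for A :: "complex multiset"
    using that by (induction A) (auto intro: algebraic_int_mult)
  have "algebraic_int c" unfolding c_def using assms(1) g p_nonzero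
    by (intro *) (auto simp: integers_def intro!: algebraic_int_conjugate[OF min_poly])
  hence "c \<in> \<int>" using prod_roots_rational[of g p] rational_algebraic_int_is_int by (auto simp: c_def)
  moreover have "c \<noteq> 0"
  proof
    assume "c = 0"
    then obtain t :: complex where "rat_eval t p = 0" "rat_eval t g = 0"
      using p_nonzero by (auto simp: c_def complex_roots_iff)
    hence "rat_eval \<theta> g = 0" by (rule min_poly_common_root[OF min_poly])
    thus False using assms(2) by (simp add: g)
  qed
  ultimately have "1 \<le> norm c" by (auto elim!: Ints_cases simp flip: of_int_abs)
  thus ?thesis unfolding g prod_conjugates c_def .
qed

text \<open>Bounded conjugates bound the coefficients of the integer polynomial with these roots.
  Finitely many such polynomials exist, each with finitely many roots.\<close>

lemma northcott: "finite {x \<in> integers. \<forall>i\<in>{..<length ts}. norm (conjugate \<theta> (ts ! i) x) \<le> B}"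
proof (rule finite_subset)
  define C where "C = \<lfloor>(\<bar>B\<bar> + 1) ^ length ts\<rfloor>"
  define F where "F = {f :: int poly. Polynomial.degree f \<le> length ts \<and> (\<forall>i. \<bar>Polynomial.coeff f i\<bar> \<le> C)}"
  show "{x \<in> integers. \<forall>i\<in>{..<length ts}. norm (conjugate \<theta> (ts ! i) x) \<le> B} \<subseteq>
    (\<Union>f\<in>F - {0}. {x. poly (map_poly of_int f) x = 0})"
  proof
    fix x assume x: "x \<in> {x \<in> integers. \<forall>i\<in>{..<length ts}. norm (conjugate \<theta> (ts ! i) x) \<le> B}"
    then obtain g where g: "x = rat_eval \<theta> g" "algebraic_int (rat_eval \<theta> g)" by (auto simp: integers_def)
    obtain f where f: "map_poly of_int f = (\<Prod>t\<in>#complex_roots p. [:- rat_eval t g, 1:])"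
      using conjugates_char_poly[OF min_poly g(2)] by blast
    define A where "A = image_mset (\<lambda>t. rat_eval t g) (complex_roots p)"
    have fA: "map_poly of_int f = (\<Prod>a\<in>#A. [:- a, 1:])"
      by (simp add: A_def f image_mset.compositionality o_def)
    have A: "A = mset (map (\<lambda>t. rat_eval t g) ts)" by (simp add: A_def flip: ts)
    hence size: "size A = length ts" by simp
    have "norm a \<le> \<bar>B\<bar>" if "a \<in># A" for a
    proof -
      obtain t where "t \<in> set ts" "a = rat_eval t g" using \<open>a \<in># A\<close> unfolding A by auto
      then obtain i where "i < length ts" "a = rat_eval (ts ! i) g" by (auto simp: in_set_conv_nth)
      thus ?thesis using x by (auto simp: g conjugate_nth intro: order_trans)
    qed
    hence "norm (Polynomial.coeff (map_poly of_int f) i :: complex) \<le> (\<bar>B\<bar> + 1) ^ size A" for i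
      unfolding fA by (intro norm_coeff_prod_linear_le) auto
    hence "\<bar>real_of_int (Polynomial.coeff f i)\<bar> \<le> (\<bar>B\<bar> + 1) ^ length ts" for i by (simp add: size)
    hence "\<bar>Polynomial.coeff f i\<bar> \<le> C" for i by (simp add: C_def le_floor_iff)
    moreover have "Polynomial.degree f \<le> length ts"
    proof -
      have "Polynomial.degree (\<Prod>a\<in>#A. [:- a, 1:]) \<le> size A"
      proof (induction A)
        case (add a A)
        have "Polynomial.degree ([:- a, 1:] * (\<Prod>a\<in>#A. [:- a, 1:])) \<le> 1 + size A"
          by (rule order_trans[OF degree_mult_le]) (use add in simp)
        thus ?case by simp
      qed simp
      thus ?thesis using size by (simp flip: fA)
    qed
    moreover have "f \<noteq> 0"
    proof
      assume "f = 0"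
      hence "(\<Prod>a\<in>#A. [:- a, 1:]) = 0" using fA by simp
      thus False by auto
    qed
    moreover have "poly (map_poly of_int f) x = 0"
    proof -
      \<comment> \<open>The polynomial vanishes at the conjugate g(t) by construction; composition
        with g makes this a rational equation for t, which transfers to \<theta>.\<close>
      define t where "t = ts ! 0"
      have t: "rat_eval t p = 0" using ts_nonempty nth_root[of 0] by (simp add: t_def)
      hence "t \<in># complex_roots p" using complex_roots_iff[OF p_nonzero] by simp
      hence "poly (map_poly of_int f) (rat_eval t g) = 0"
        unfolding f by (auto simp: poly_prod_mset)
      hence "rat_eval t (map_poly of_int f \<circ>\<^sub>p g) = 0" by (simp add: poly_of_int_eq_rat_eval)
      hence "rat_eval \<theta> (map_poly of_int f \<circ>\<^sub>p g) = 0" by (rule min_poly_common_root[OF min_poly t])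
      thus ?thesis by (simp add: poly_of_int_eq_rat_eval g)
    qed
    ultimately show "x \<in> (\<Union>f\<in>F - {0}. {x. poly (map_poly of_int f) x = 0})" by (auto simp: F_def)
  qed
  have "finite F" unfolding F_def by (rule finite_int_polys_bounded)
  thus "finite (\<Union>f\<in>F - {0}. {x :: 'k. poly (map_poly of_int f) x = 0})"
    by (auto intro!: poly_roots_finite)
qed

sublocale archimedean_places integers "{..<length ts}" "\<lambda>i. conjugate \<theta> (ts ! i)"
proof
  have simps: "1 = rat_eval \<theta> 1" by simp
  show "1 \<in> integers" by (auto simp: integers_def intro: int_imp_algebraic_int simp flip: simps) (metis simps rangeI)
  show "x + y \<in> integers" "x * y \<in> integers" if "x \<in> integers" "y \<in> integers" for x y
    using that by (auto simp: integers_def algebraic_int_add algebraic_int_mult simp flip: rat_eval_simps)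
  show "- x \<in> integers" if "x \<in> integers" for x
    using that by (auto simp: integers_def simp flip: rat_eval_minus)
  fix i assume i: "i \<in> {..<length ts}"
  show "conjugate \<theta> (ts ! i) 1 = 1" using conjugate_nth[of i 1] i by simp
  fix x y assume "x \<in> integers" "y \<in> integers"
  then obtain g h where "x = rat_eval \<theta> g" "y = rat_eval \<theta> h" by (auto simp: integers_def)
  thus "conjugate \<theta> (ts ! i) (x + y) = conjugate \<theta> (ts ! i) x + conjugate \<theta> (ts ! i) y"
    "conjugate \<theta> (ts ! i) (x * y) = conjugate \<theta> (ts ! i) x * conjugate \<theta> (ts ! i) y"
    using i conjugate_nth[of i] by (simp_all flip: rat_eval_simps)
qed (use norm_ge_1 northcott in auto)

end

theorem finite_exceptional_units_simple_extension:
  assumes "algebraic (\<theta> :: 'k::field_char_0)"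
  shows "finite {x \<in> range (rat_eval \<theta>). x \<noteq> 0 \<and> x \<noteq> 1 \<and> algebraic_int x \<and> algebraic_int (inverse x) \<and>
    algebraic_int (inverse (1 - x)) \<and> inverse x \<in> range (rat_eval \<theta>) \<and> inverse (1 - x) \<in> range (rat_eval \<theta>)}"
proof -
  obtain p where p: "is_min_poly \<theta> p" using ex_min_poly[OF assms] by blast
  obtain ts where "mset ts = complex_roots p" using ex_mset by blast
  then interpret simple_extension \<theta> p ts using p by unfold_locales
  show ?thesis
  proof (rule finite_subset[OF _ finite_exceptional_units], safe)
    fix x g h k assume x: "rat_eval \<theta> g \<noteq> 0" "rat_eval \<theta> g \<noteq> 1" "algebraic_int (rat_eval \<theta> g)"
      "algebraic_int (inverse (rat_eval \<theta> g))" "algebraic_int (inverse (1 - rat_eval \<theta> g))"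
      "inverse (rat_eval \<theta> g) = rat_eval \<theta> h" "inverse (1 - rat_eval \<theta> g) = rat_eval \<theta> k"
    have "rat_eval \<theta> g \<in> integers" "inverse (rat_eval \<theta> g) \<in> integers"
      "inverse (1 - rat_eval \<theta> g) \<in> integers"
      using x by (auto simp: integers_def)
    thus "rat_eval \<theta> g \<in> exceptional_units"
      using x(1,2) by (auto simp: exceptional_units_def units_def intro: diff_R one_R)
  qed
qed

section \<open>Primitive elements\<close>

definition rat_adjoin :: "'a::field_char_0 \<Rightarrow> 'a set" where
  "rat_adjoin x = range (rat_eval x)"

lemma rat_adjoin_add: "y \<in> rat_adjoin x \<Longrightarrow> z \<in> rat_adjoin x \<Longrightarrow> y + z \<in> rat_adjoin x"
  by (auto simp: rat_adjoin_def simp flip: rat_eval_simps)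

lemma rat_adjoin_mult: "y \<in> rat_adjoin x \<Longrightarrow> z \<in> rat_adjoin x \<Longrightarrow> y * z \<in> rat_adjoin x"
  by (auto simp: rat_adjoin_def simp flip: rat_eval_simps)

lemma rat_adjoin_diff: "y \<in> rat_adjoin x \<Longrightarrow> z \<in> rat_adjoin x \<Longrightarrow> y - z \<in> rat_adjoin x"
  by (auto simp: rat_adjoin_def simp flip: rat_eval_simps)

lemma rat_adjoin_uminus: "y \<in> rat_adjoin x \<Longrightarrow> - y \<in> rat_adjoin x"
  by (auto simp: rat_adjoin_def simp flip: rat_eval_minus)

lemma rat_adjoin_of_rat: "of_rat c \<in> rat_adjoin x"
  unfolding rat_adjoin_def by (metis rangeI rat_eval_simps(6))

lemma rat_adjoin_self: "x \<in> rat_adjoin x"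
  unfolding rat_adjoin_def by (metis rangeI rat_eval_simps(7))

lemma rat_adjoin_0: "0 \<in> rat_adjoin x" and rat_adjoin_1: "1 \<in> rat_adjoin x"
  using rat_adjoin_of_rat[of 0 x] rat_adjoin_of_rat[of 1 x] by simp_all

lemma rat_adjoin_sum: "(\<And>i. i \<in> I \<Longrightarrow> f i \<in> rat_adjoin x) \<Longrightarrow> (\<Sum>i\<in>I. f i) \<in> rat_adjoin x"
  by (induction I rule: infinite_finite_induct) (auto intro: rat_adjoin_0 rat_adjoin_add)

lemma rat_adjoin_mono: "y \<in> rat_adjoin x \<Longrightarrow> rat_adjoin y \<subseteq> rat_adjoin x"
  by (auto simp: rat_adjoin_def simp flip: rat_eval_simps)

text \<open>A Bezout relation with the minimal polynomial makes the ring Q[x] a field.\<close>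

lemma rat_adjoin_inverse:
  assumes "algebraic x" "y \<in> rat_adjoin x"
  shows "inverse y \<in> rat_adjoin x"
proof (cases "y = 0")
  case False
  obtain p where p: "is_min_poly x p" using ex_min_poly[OF assms(1)] by blast
  obtain g where g: "y = rat_eval x g" using assms(2) by (auto simp: rat_adjoin_def)
  obtain a b where "a * p + b * g = 1" using min_poly_bezout[OF p] False g by blast
  hence "rat_eval x (a * p + b * g) = 1" by simp
  hence "rat_eval x b * y = 1" using p by (simp add: g is_min_poly_def)
  hence "inverse y = rat_eval x b" by (metis inverse_unique mult.commute)
  thus ?thesis by (simp add: rat_adjoin_def)
qed (simp add: rat_adjoin_0)

lemma rat_adjoin_divide:
  "algebraic x \<Longrightarrow> y \<in> rat_adjoin x \<Longrightarrow> z \<in> rat_adjoin x \<Longrightarrow> y / z \<in> rat_adjoin x"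
  by (simp add: divide_inverse rat_adjoin_inverse rat_adjoin_mult)

section \<open>Polynomials with coefficients in Q(x)\<close>

definition poly_over :: "'a::comm_ring_1 set \<Rightarrow> 'a poly set" where
  "poly_over F = {f. \<forall>i. Polynomial.coeff f i \<in> F}"

lemma poly_over_rat_adjoin_mult:
  "f \<in> poly_over (rat_adjoin x) \<Longrightarrow> g \<in> poly_over (rat_adjoin x) \<Longrightarrow> f * g \<in> poly_over (rat_adjoin x)"
  by (auto simp: poly_over_def coeff_mult intro: rat_adjoin_sum rat_adjoin_mult)

lemma poly_over_rat_adjoin_pCons:
  "c \<in> rat_adjoin x \<Longrightarrow> f \<in> poly_over (rat_adjoin x) \<Longrightarrow> pCons c f \<in> poly_over (rat_adjoin x)"
  by (auto simp: poly_over_def coeff_pCons split: nat.splits)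

lemma poly_over_rat_adjoin_0: "0 \<in> poly_over (rat_adjoin x)"
  by (simp add: poly_over_def rat_adjoin_0)

lemma poly_over_rat_adjoin_of_rat: "map_poly of_rat p \<in> poly_over (rat_adjoin x)"
  by (simp add: poly_over_def rat_adjoin_of_rat)

lemma poly_over_rat_adjoin_pcompose:
  assumes "g \<in> poly_over (rat_adjoin x)"
  shows "f \<in> poly_over (rat_adjoin x) \<Longrightarrow> f \<circ>\<^sub>p g \<in> poly_over (rat_adjoin x)"
proof (induction f)
  case (pCons c f)
  have "c \<in> rat_adjoin x" "f \<in> poly_over (rat_adjoin x)"
  proof -
    have "Polynomial.coeff (pCons c f) i \<in> rat_adjoin x" for i using pCons(3) by (simp add: poly_over_def)
    from this[of 0] this[of "Suc i" for i] show "c \<in> rat_adjoin x" "f \<in> poly_over (rat_adjoin x)"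
      by (auto simp: poly_over_def)
  qed
  hence "[:c:] \<in> poly_over (rat_adjoin x)" "g * f \<circ>\<^sub>p g \<in> poly_over (rat_adjoin x)"
    using pCons(2) assms
    by (auto intro: poly_over_rat_adjoin_pCons poly_over_rat_adjoin_0 poly_over_rat_adjoin_mult)
  thus ?case by (auto simp: pcompose_pCons poly_over_def intro: rat_adjoin_add)
qed (simp add: poly_over_rat_adjoin_0)

text \<open>The remainder must keep its coefficients in Q(x). Cancelling leading terms divides only
  by the leading coefficient of h, which stays inside the field Q(x).\<close>

lemma poly_over_rat_adjoin_division:
  assumes x: "algebraic x" and h: "h \<in> poly_over (rat_adjoin x)" "h \<noteq> 0"
    and "f \<in> poly_over (rat_adjoin x)"
  shows "\<exists>u r. f = h * u + r \<and> r \<in> poly_over (rat_adjoin x) \<and> (r = 0 \<or> Polynomial.degree r < Polynomial.degree h)"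
  using assms(4)
proof (induction "Polynomial.degree f" arbitrary: f rule: less_induct)
  case less
  show ?case
  proof (cases "Polynomial.degree f < Polynomial.degree h")
    case True
    thus ?thesis using less(2) by (intro exI[of _ 0] exI[of _ f]) auto
  next
    case False
    define d where "d = Polynomial.degree f - Polynomial.degree h"
    define m where "m = Polynomial.monom (Polynomial.lead_coeff f / Polynomial.lead_coeff h) d"
    define f' where "f' = f - m * h"
    have f': "f' \<in> poly_over (rat_adjoin x)"
      using less(2) h(1) x unfolding f'_def m_def poly_over_def
      by (auto simp: coeff_monom_mult intro!: rat_adjoin_diff rat_adjoin_mult rat_adjoin_divide rat_adjoin_0)
    have dd: "d + Polynomial.degree h = Polynomial.degree f" using False by (simp add: d_def)
    have "Polynomial.coeff f' (Polynomial.degree f) = 0"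
      using h(2) by (simp add: f'_def m_def coeff_monom_mult flip: dd)
    moreover have "Polynomial.degree f' \<le> Polynomial.degree f"
      unfolding f'_def m_def
      by (intro degree_diff_le order_trans[OF degree_mult_le] order_trans[OF add_right_mono[OF degree_monom_le]])
         (simp_all add: dd)
    ultimately have "f' = 0 \<or> Polynomial.degree f' < Polynomial.degree f" by (rule eq_zero_or_degree_less[rotated])
    hence "\<exists>u r. f' = h * u + r \<and> r \<in> poly_over (rat_adjoin x) \<and> (r = 0 \<or> Polynomial.degree r < Polynomial.degree h)"
    proof
      assume "f' = 0"
      thus ?thesis by (intro exI[of _ 0]) (simp add: poly_over_rat_adjoin_0)
    qed (use less(1) f' in blast)
    then obtain u r where ur: "f' = h * u + r" "r \<in> poly_over (rat_adjoin x)"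
      "r = 0 \<or> Polynomial.degree r < Polynomial.degree h" by blast
    have "f = h * (u + m) + r" using ur(1) by (simp add: f'_def algebra_simps)
    thus ?thesis using ur by blast
  qed
qed

lemma min_poly_separable:
  assumes "is_min_poly x q"
  shows "rat_eval x (pderiv q) \<noteq> 0"
proof
  assume 0: "rat_eval x (pderiv q) = 0"
  have "Polynomial.degree q \<noteq> 0"
  proof
    assume "Polynomial.degree q = 0"
    then obtain c where "q = [:c:]" using degree_eq_zeroE by blast
    thus False using assms by (simp add: is_min_poly_def)
  qed
  hence "pderiv q \<noteq> 0" "Polynomial.degree (pderiv q) < Polynomial.degree q"
    by (simp_all add: pderiv_eq_0_iff degree_pderiv)
  thus False using assms 0 by (auto simp: is_min_poly_def)
qed

text \<open>For all but finitely many \<open>c\<close>, the conjugates \<open>\<alpha>\<close> and \<open>\<beta>\<close> are the only ones with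
  \<open>\<alpha> + c\<beta> = \<theta>\<close>. Then \<open>\<beta>\<close> is the only common root of \<open>q(X)\<close> and \<open>p(\<theta> - cX)\<close>, so its minimal
  polynomial over \<open>\<rat>(\<theta>)\<close> is linear.\<close>

lemma primitive_element:
  fixes \<alpha> \<beta> :: "'a::{alg_closed_field, field_char_0}"
  assumes "algebraic_int \<alpha>" "algebraic_int \<beta>"
  obtains \<theta> where "algebraic_int \<theta>" "\<alpha> \<in> rat_adjoin \<theta>" "\<beta> \<in> rat_adjoin \<theta>"
proof -
  obtain p q where p: "is_min_poly \<alpha> p" and q: "is_min_poly \<beta> q"
    using assms ex_min_poly algebraic_int_imp_algebraic by metis
  have p0: "p \<noteq> 0" "rat_eval \<alpha> p = 0" and q0: "q \<noteq> 0" "rat_eval \<beta> q = 0"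
    using p q by (auto simp: is_min_poly_def)
  define P :: "'a poly" where "P = map_poly of_rat p"
  define Q :: "'a poly" where "Q = map_poly of_rat q"
  have "finite {a. poly P a = 0}" "finite {b. poly Q b = 0}"
    using p0(1) q0(1) by (auto simp: P_def Q_def simp del: poly_map_poly_of_rat intro!: poly_roots_finite)
  hence "finite ((\<lambda>(a, b). (a - \<alpha>) / (\<beta> - b)) ` ({a. poly P a = 0} \<times> {b. poly Q b = 0}))" by simp
  \<comment> \<open>Natural numbers give infinitely many candidates for c and keep \<theta> an
    algebraic integer.\<close>
  moreover have "infinite (range (of_nat :: nat \<Rightarrow> 'a))" by (simp add: range_inj_infinite inj_of_nat)
  ultimately obtain c where
    c: "of_nat c \<notin> (\<lambda>(a, b). (a - \<alpha>) / (\<beta> - b)) ` ({a. poly P a = 0} \<times> {b. poly Q b = 0})"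
    using finite_subset[of "range of_nat"] by blast
  define \<theta> where "\<theta> = \<alpha> + of_nat c * \<beta>"
  have \<theta>: "algebraic_int \<theta>" unfolding \<theta>_def
    by (intro algebraic_int_add algebraic_int_mult assms int_imp_algebraic_int) auto
  hence alg: "algebraic \<theta>" by (rule algebraic_int_imp_algebraic)
  define R where "R = P \<circ>\<^sub>p [:\<theta>, - of_nat c:]"
  define ok where "ok = (\<lambda>h. h \<noteq> 0 \<and> h \<in> poly_over (rat_adjoin \<theta>) \<and> poly h \<beta> = 0)"
  have cF: "of_nat c \<in> rat_adjoin \<theta>" using rat_adjoin_of_rat[of "of_nat c" \<theta>] by simp
  have Q_over: "Q \<in> poly_over (rat_adjoin \<theta>)" unfolding Q_def by (rule poly_over_rat_adjoin_of_rat)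
  have R_over: "R \<in> poly_over (rat_adjoin \<theta>)" unfolding R_def P_def
    by (intro poly_over_rat_adjoin_pcompose poly_over_rat_adjoin_of_rat poly_over_rat_adjoin_pCons
        poly_over_rat_adjoin_0 rat_adjoin_uminus rat_adjoin_self cF)
  have "ok Q" using q0 Q_over by (simp add: ok_def Q_def)
  \<comment> \<open>The polynomial h acts as the minimal polynomial of \<beta> over
    Q(\<theta>).\<close>
  from ex_has_least_nat[of ok, OF this, of Polynomial.degree]
  obtain h where h: "ok h" and least: "\<And>g. ok g \<Longrightarrow> Polynomial.degree h \<le> Polynomial.degree g" by blast
  have h_dvd: "h dvd f" if f: "f \<in> poly_over (rat_adjoin \<theta>)" "poly f \<beta> = 0" for f
  proof -
    obtain u r where ur: "f = h * u + r" "r \<in> poly_over (rat_adjoin \<theta>)"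
      "r = 0 \<or> Polynomial.degree r < Polynomial.degree h"
      using poly_over_rat_adjoin_division[OF alg _ _ f(1), of h] h unfolding ok_def by blast
    have "poly r \<beta> = 0" using f(2) h by (simp add: ur(1) ok_def)
    hence "r = 0" using ur(2,3) least[of r] leD unfolding ok_def by blast
    thus ?thesis by (simp add: ur(1))
  qed
  have hQ: "h dvd Q" using q0 by (intro h_dvd Q_over) (simp add: Q_def)
  have hR: "h dvd R" using p0 by (intro h_dvd R_over) (simp add: R_def P_def poly_pcompose \<theta>_def mult.commute)
  have root: "b = \<beta>" if "poly h b = 0" for b
  proof (rule ccontr)
    assume "b \<noteq> \<beta>"
    have "poly Q b = 0" "poly R b = 0" using that hQ hR by (auto elim!: dvdE)
    hence "poly P (\<theta> - of_nat c * b) = 0" by (simp add: R_def poly_pcompose mult.commute)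
    \<comment> \<open>A second common root b would make c one of the excluded quotients.\<close>
    moreover have "of_nat c = ((\<theta> - of_nat c * b) - \<alpha>) / (\<beta> - b)"
      using \<open>b \<noteq> \<beta>\<close> by (simp add: \<theta>_def field_simps)
    ultimately show False using c \<open>poly Q b = 0\<close> by force
  qed
  obtain h2 where h2: "h = [:- \<beta>, 1:] * h2" using h by (auto simp: ok_def poly_eq_0_iff_dvd elim!: dvdE)
  \<comment> \<open>Otherwise \<beta> would be a double root of h, hence of Q, although q is
    separable.\<close>
  have "Polynomial.degree h2 = 0"
  proof (rule ccontr)
    assume "Polynomial.degree h2 \<noteq> 0"
    then obtain b where "poly h2 b = 0" using alg_closed_imp_poly_has_root[of h2] by auto
    hence "poly h2 \<beta> = 0" using root[of b] by (simp add: h2)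
    then obtain h3 where h3: "h2 = [:- \<beta>, 1:] * h3" by (auto simp: poly_eq_0_iff_dvd elim!: dvdE)
    obtain e where "Q = h * e" using hQ by (auto elim: dvdE)
    hence "Q = [:- \<beta>, 1:] * ([:- \<beta>, 1:] * (h3 * e))" by (simp only: h2 h3 mult.assoc)
    moreover have "poly (pderiv (l * (l * w))) \<beta> = 0" if "poly l \<beta> = 0" for l w
      using that by (simp add: pderiv_mult)
    from this[of "[:- \<beta>, 1:]" "h3 * e"] have "poly (pderiv ([:- \<beta>, 1:] * ([:- \<beta>, 1:] * (h3 * e)))) \<beta> = 0"
      by simp
    ultimately have "poly (pderiv Q) \<beta> = 0" by (simp only:)
    hence "rat_eval \<beta> (pderiv q) = 0" by (simp add: Q_def flip: of_rat_hom.map_poly_pderiv)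
    thus False using min_poly_separable[OF q] by simp
  qed
  then obtain k where k: "h2 = [:k:]" using degree_eq_zeroE by blast
  have hk: "h = [:- (\<beta> * k), k:]" by (simp add: h2 k)
  have "k \<noteq> 0" using h by (auto simp: ok_def hk)
  have coeffs: "Polynomial.coeff h 0 \<in> rat_adjoin \<theta>" "Polynomial.coeff h 1 \<in> rat_adjoin \<theta>"
    using h by (auto simp: ok_def poly_over_def)
  hence "- (Polynomial.coeff h 0 / Polynomial.coeff h 1) \<in> rat_adjoin \<theta>"
    by (intro rat_adjoin_uminus rat_adjoin_divide alg)
  hence \<beta>: "\<beta> \<in> rat_adjoin \<theta>" using \<open>k \<noteq> 0\<close> by (simp add: hk)
  have "\<theta> - of_nat c * \<beta> \<in> rat_adjoin \<theta>"
    by (intro rat_adjoin_diff rat_adjoin_mult rat_adjoin_self cF \<beta>)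
  hence "\<alpha> \<in> rat_adjoin \<theta>" by (simp add: \<theta>_def)
  thus thesis using that \<theta> \<beta> by blast
qed

lemma primitive_element_finite_set:
  fixes A :: "'a::{alg_closed_field, field_char_0} set"
  assumes "finite A" "\<And>x. x \<in> A \<Longrightarrow> algebraic_int x"
  shows "\<exists>\<theta>. algebraic_int \<theta> \<and> A \<subseteq> rat_adjoin \<theta>"
  using assms
proof (induction A rule: finite_induct)
  case empty
  show ?case by (intro exI[of _ 0]) auto
next
  case (insert x A)
  then obtain \<theta> where \<theta>: "algebraic_int \<theta>" "A \<subseteq> rat_adjoin \<theta>" by auto
  obtain \<theta>' where \<theta>': "algebraic_int \<theta>'" "\<theta> \<in> rat_adjoin \<theta>'" "x \<in> rat_adjoin \<theta>'"
    using primitive_element[OF \<theta>(1), of x] insert by auto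
  thus ?case using \<theta>(2) rat_adjoin_mono[OF \<theta>'(2)] by blast
qed

section \<open>Splitting fields of trinomials\<close>

lemma rat_common_denominator:
  assumes "finite C"
  shows "\<exists>n>0. \<forall>c\<in>C. \<exists>k. of_nat n * c = (of_int k :: rat)"
  using assms
proof (induction C rule: finite_induct)
  case (insert c C)
  then obtain n where n: "n > 0" "\<forall>c\<in>C. \<exists>k. of_nat n * c = (of_int k :: rat)" by blast
  obtain a b where ab: "quotient_of c = (a, b)" by (cases "quotient_of c")
  have b: "b > 0" "c = of_int a / of_int b"
    using quotient_of_denom_pos[OF ab] quotient_of_div[OF ab] by simp_all
  have "\<exists>k. of_nat (n * nat b) * d = (of_int k :: rat)" if "d \<in> insert c C" for d
  proof (cases "d = c")
    case True
    thus ?thesis using b by (intro exI[of _ "int n * a"]) simp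
  next
    case False
    hence "d \<in> C" using that by simp
    with n(2) obtain k where "of_nat n * d = (of_int k :: rat)" by metis
    thus ?thesis using b by (intro exI[of _ "k * b"]) (simp add: mult_ac)
  qed
  thus ?case using n(1) b(1) by (intro exI[of _ "n * nat b"]) auto
qed auto

text \<open>Multiplication by x has a rational matrix in the basis B; with a common denominator n of
  its entries, n x maps B into its integer span.\<close>

lemma number_field_ex_multiple_algebraic_int:
  fixes B :: "'m::field_char_0 set" and x :: 'm
  assumes "finite_dimensional_vector_space (\<lambda>(q::rat) (x::'m). of_rat q * x) B"
  shows "\<exists>n>0. algebraic_int (of_nat n * x)"
proof -
  interpret finite_dimensional_vector_space "\<lambda>(q::rat) (x::'m). of_rat q * x" B by fact
  have "\<exists>u. y = (\<Sum>w\<in>B. of_rat (u w) * w)" for y :: 'm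
    using span_Basis span_finite[OF finite_Basis] by blast
  hence "\<exists>u. \<forall>v. x * v = (\<Sum>w\<in>B. of_rat (u v w) * w)" by (intro choice allI) blast
  then obtain u where u: "x * v = (\<Sum>w\<in>B. of_rat (u v w) * w)" for v by blast
  obtain n where n: "n > 0" "\<forall>c\<in>(\<lambda>(v, w). u v w) ` (B \<times> B). \<exists>k. of_nat n * c = (of_int k :: rat)"
    using rat_common_denominator[of "(\<lambda>(v, w). u v w) ` (B \<times> B)"] finite_Basis by blast
  have "\<exists>k. of_nat n * u v w = of_int k" if "v \<in> B" "w \<in> B" for v w using n(2) that by auto
  then obtain k where k: "of_nat n * u v w = of_int (k v w)" if "v \<in> B" "w \<in> B" for v w by metis
  have "of_nat n * x * v \<in> int_span B" if v: "v \<in> B" for v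
  proof -
    have "of_nat n * x * v = (\<Sum>w\<in>B. of_rat (of_nat n * u v w) * w)"
      by (simp add: mult.assoc u sum_distrib_left of_rat_mult)
    also have "\<dots> = (\<Sum>w\<in>B. of_int (k v w) * w)"
      by (intro sum.cong refl) (simp add: k[OF v])
    finally show ?thesis unfolding int_span_def by blast
  qed
  hence st: "of_nat n * x \<in> int_stabilizer B" by (simp add: int_stabilizer_def)
  have "B \<noteq> {}"
  proof
    assume "B = {}"
    hence "(1::'m) \<in> span {}" using span_Basis by simp
    thus False by simp
  qed
  then obtain w where "w \<in> B" by blast
  moreover have "0 \<notin> B" using independent_Basis dependent_zero by blast
  ultimately have "algebraic_int (of_nat n * x)"
    using st by (intro int_stabilizer_imp_algebraic_int[OF finite_Basis]) auto
  thus ?thesis using n(1) by blast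
qed

lemma algebraic_int_to_ac:
  assumes "algebraic_int (x :: 'm::field_char_0)"
  shows "algebraic_int (to_ac x)"
proof -
  obtain n a where a: "n > 0" "x ^ n = (\<Sum>i<n. of_int (a i) * x ^ i)"
    using assms by (rule algebraic_int_relation)
  have "to_ac x ^ n = (\<Sum>i<n. of_int (a i) * to_ac x ^ i)"
    using arg_cong[OF a(2), of to_ac] by (simp add: to_ac_sum)
  thus ?thesis
    by (intro algebraic_int_monic_relation[of n _ a] a(1))
qed

lemma to_ac_of_rat: "to_ac (of_rat q) = of_rat q"
  by (cases q) (simp add: of_rat_rat)

lemma splitting_field_subset:
  fixes f :: "'m::field_char_0 poly"
  assumes "range to_ac \<union> {x. poly (map_poly to_ac f) x = 0} \<subseteq> rat_adjoin \<theta>" "algebraic \<theta>"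
  shows "splitting_field f \<subseteq> rat_adjoin \<theta>"
proof
  interpret field "ring_of_type_algebra :: 'm alg_closure ring" by (rule field_from_type_algebra)
  fix x assume "x \<in> splitting_field f"
  thus "x \<in> rat_adjoin \<theta>" unfolding splitting_field_def
  proof (induction rule: generate_field.induct)
    case (incl h)
    thus ?case using assms(1) by blast
  next
    case (a_inv h)
    have "\<ominus>\<^bsub>ring_of_type_algebra\<^esub> h = - h"
      by (intro minus_equality) (simp_all add: ring_of_type_algebra_def)
    thus ?case using a_inv by (simp add: rat_adjoin_uminus)
  next
    case (m_inv h)
    have "h \<noteq> 0" using m_inv by (simp add: ring_of_type_algebra_def)
    hence "inv\<^bsub>ring_of_type_algebra\<^esub> h = inverse h"
      by (intro comm_inv_char) (simp_all add: ring_of_type_algebra_def)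
    thus ?case using m_inv rat_adjoin_inverse[OF assms(2)] by simp
  qed (simp_all add: ring_of_type_algebra_def rat_adjoin_1 rat_adjoin_add rat_adjoin_mult)
qed

lemma splitting_field_root: "poly (map_poly to_ac f) x = 0 \<Longrightarrow> x \<in> splitting_field f"
  unfolding splitting_field_def by (intro generate_field.incl) simp

lemma poly_trinomial: "poly (map_poly to_ac [:a, a, 0, 1:]) x = x ^ 3 + to_ac a * x + to_ac a"
  by (simp add: map_poly_pCons power3_eq_cube algebra_simps)

text \<open>For roots \<open>r, s, t\<close> the witness is \<open>x = - s / t\<close>; then \<open>1 - x = - r / t\<close>, because the
  roots sum to zero.\<close>

lemma trinomial_unit:
  fixes b :: "'a::{alg_closed_field, field_char_0}"
  assumes b: "b \<noteq> 0" and F: "algebraic \<theta>" "\<And>t. t ^ 3 + b * t + b = 0 \<Longrightarrow> t \<in> rat_adjoin \<theta>"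
  obtains x where "x \<in> rat_adjoin \<theta>" "x \<noteq> 0" "x \<noteq> 1" "b * x\<^sup>2 * (1 - x)\<^sup>2 + (x\<^sup>2 - x + 1) ^ 3 = 0"
proof -
  have "Polynomial.degree [:b, b, 0, 1:] > 0" by simp
  then obtain t where t': "poly [:b, b, 0, 1:] t = 0" using alg_closed_imp_poly_has_root by blast
  hence t: "t ^ 3 + b * t + b = 0" by (simp add: power3_eq_cube algebra_simps)
  \<comment> \<open>This quadratic is the cofactor of X - t in the cubic.\<close>
  have "Polynomial.degree [:t\<^sup>2 + b, t, 1:] > 0" by simp
  then obtain s where "poly [:t\<^sup>2 + b, t, 1:] s = 0" using alg_closed_imp_poly_has_root by blast
  hence s: "s\<^sup>2 + t * s + t\<^sup>2 + b = 0" by (simp add: power2_eq_square algebra_simps)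
  have "s ^ 3 + b * s + b = (s - t) * (s\<^sup>2 + t * s + t\<^sup>2 + b) + (t ^ 3 + b * t + b)"
    by (simp add: power2_eq_square power3_eq_cube algebra_simps)
  hence s': "s ^ 3 + b * s + b = 0" using s t by simp
  have nz: "t \<noteq> 0" "s \<noteq> 0" using b t s' by auto
  define r where "r = - s - t"
  have r_eq: "r ^ 3 + b * r + b = (t ^ 3 + b * t + b) - (s + 2 * t) * (s\<^sup>2 + t * s + t\<^sup>2 + b)"
    by (simp add: r_def power2_eq_square power3_eq_cube algebra_simps)
  hence "r ^ 3 + b * r + b = 0" using s t by simp
  hence "r \<noteq> 0" using b by auto
  define x where "x = - s / t"
  have x: "s = - (x * t)" using nz by (simp add: x_def)
  have "x \<noteq> 1" using \<open>r \<noteq> 0\<close> nz by (auto simp: x_def r_def field_simps)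
  moreover have "x \<noteq> 0" using nz by (simp add: x_def)
  moreover have "x \<in> rat_adjoin \<theta>" unfolding x_def
    by (intro rat_adjoin_divide rat_adjoin_uminus F s' t)
  moreover have "b * x\<^sup>2 * (1 - x)\<^sup>2 + (x\<^sup>2 - x + 1) ^ 3 = 0"
  proof -
    define w where "w = x\<^sup>2 - x + 1"
    \<comment> \<open>The quadratic at s = - x t expresses b; the cubic at t then becomes t (1 - w)
      = w, which eliminates t.\<close>
    have bw: "b = - (w * t\<^sup>2)"
      using s by (simp add: x w_def eq_neg_iff_add_eq_0 power2_eq_square algebra_simps)
    have "t * t * (t * (1 - w) - w) = 0"
      using t by (simp add: bw power2_eq_square power3_eq_cube algebra_simps)
    hence "t * (1 - w) = w" using nz by simp
    moreover have "1 - w = x * (1 - x)" by (simp add: w_def power2_eq_square algebra_simps)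
    ultimately have tw: "t * (x * (1 - x)) = w" by simp
    have "b * x\<^sup>2 * (1 - x)\<^sup>2 = - (w * (t * (x * (1 - x)))\<^sup>2)"
      by (simp add: bw power_mult_distrib mult_ac)
    also have "\<dots> = - (w ^ 3)" unfolding tw by (simp add: power2_eq_square power3_eq_cube)
    finally show ?thesis by (simp add: w_def)
  qed
  ultimately show thesis using that by blast
qed

text \<open>The sextic is invariant under x -> 1 - x and, up to a sixth power, under x -> 1 / x. So
  all three elements are roots of the same monic equation over Z[b].\<close>

lemma sextic_units:
  fixes b x :: "'a::field_char_0"
  assumes b: "algebraic_int b" and x: "x \<noteq> 0" "x \<noteq> 1"
    and eq: "b * x\<^sup>2 * (1 - x)\<^sup>2 + (x\<^sup>2 - x + 1) ^ 3 = 0"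
  shows "algebraic_int x" "algebraic_int (inverse x)" "algebraic_int (inverse (1 - x))"
proof -
  have inv: "b * (inverse y)\<^sup>2 * (1 - inverse y)\<^sup>2 + ((inverse y)\<^sup>2 - inverse y + 1) ^ 3 = 0"
    if y: "y \<noteq> 0" "b * y\<^sup>2 * (1 - y)\<^sup>2 + (y\<^sup>2 - y + 1) ^ 3 = 0" for y
  proof -
    define z where "z = inverse y"
    have zy: "z * y = 1" using y by (simp add: z_def)
    have "z\<^sup>2 * y\<^sup>2 = (z * y)\<^sup>2" by (rule power_mult_distrib[symmetric])
    moreover have "z\<^sup>2 * y = z * (z * y)" by (simp only: power2_eq_square mult.assoc)
    ultimately have zy2: "z\<^sup>2 * y\<^sup>2 = 1" "z\<^sup>2 * y = z" by (simp_all add: zy)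
    have *: "1 - z = - (z * (1 - y))" "z\<^sup>2 - z + 1 = z\<^sup>2 * (y\<^sup>2 - y + 1)" "z\<^sup>2 = z ^ 4 * y\<^sup>2"
    proof -
      show "1 - z = - (z * (1 - y))" by (simp add: right_diff_distrib zy)
      show "z\<^sup>2 - z + 1 = z\<^sup>2 * (y\<^sup>2 - y + 1)" by (simp add: distrib_left right_diff_distrib zy2)
      have "z ^ 4 * y\<^sup>2 = z\<^sup>2 * (z\<^sup>2 * y\<^sup>2)" by (simp add: mult.assoc flip: power_add)
      thus "z\<^sup>2 = z ^ 4 * y\<^sup>2" by (simp add: zy2)
    qed
    have z6: "z ^ 4 * z\<^sup>2 = z ^ 6" "(z\<^sup>2) ^ 3 = z ^ 6" by (simp_all flip: power_add power_mult)
    have "b * z\<^sup>2 * (1 - z)\<^sup>2 = b * (z ^ 4 * y\<^sup>2) * (- (z * (1 - y)))\<^sup>2"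
      by (simp only: *(1) *(3)[symmetric])
    also have "\<dots> = z ^ 4 * z\<^sup>2 * (b * y\<^sup>2 * (1 - y)\<^sup>2)"
      by (simp add: power_mult_distrib mult_ac)
    finally have 1: "b * z\<^sup>2 * (1 - z)\<^sup>2 = z ^ 6 * (b * y\<^sup>2 * (1 - y)\<^sup>2)" by (simp only: z6)
    have 2: "(z\<^sup>2 - z + 1) ^ 3 = z ^ 6 * (y\<^sup>2 - y + 1) ^ 3"
      by (simp only: *(2) power_mult_distrib z6)
    have "b * z\<^sup>2 * (1 - z)\<^sup>2 + (z\<^sup>2 - z + 1) ^ 3 =
      z ^ 6 * (b * y\<^sup>2 * (1 - y)\<^sup>2 + (y\<^sup>2 - y + 1) ^ 3)"
      unfolding 1 2 by (rule distrib_left[symmetric])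
    thus ?thesis using y(2) by (simp add: z_def)
  qed
  have "b * (1 - x)\<^sup>2 * (1 - (1 - x))\<^sup>2 + ((1 - x)\<^sup>2 - (1 - x) + 1) ^ 3 =
     b * x\<^sup>2 * (1 - x)\<^sup>2 + (x\<^sup>2 - x + 1) ^ 3"
    by (simp add: power2_eq_square algebra_simps)
  hence "b * (1 - x)\<^sup>2 * (1 - (1 - x))\<^sup>2 + ((1 - x)\<^sup>2 - (1 - x) + 1) ^ 3 = 0" using eq by simp
  thus "algebraic_int (inverse (1 - x))" using x by (intro algebraic_int_sextic[OF b] inv) auto
  show "algebraic_int x" "algebraic_int (inverse x)"
    using x eq by (auto intro: algebraic_int_sextic[OF b] inv)
qed

theorem corollary4p12:
  fixes a :: "'m::field_char_0"
  assumes "number_field TYPE('m)"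
    and "a \<in> ring_of_integers"
    and "a * (4 * a + 27) \<noteq> 0"
  shows "finite {b \<in> ring_of_integers. splitting_field [:a, a, 0, 1:] = splitting_field [:b, b, 0, 1:]}"
proof -
  obtain B where B: "finite_dimensional_vector_space (\<lambda>(q::rat) (x::'m). of_rat q * x) B"
    using assms(1) unfolding number_field_def by blast
  interpret finite_dimensional_vector_space "\<lambda>(q::rat) (x::'m). of_rat q * x" B by fact
  have "\<exists>n. \<forall>v. n v > 0 \<and> algebraic_int (of_nat (n v) * v :: 'm)"
    using number_field_ex_multiple_algebraic_int[OF B] by (intro choice allI) blast
  then obtain n where n: "n v > 0" "algebraic_int (of_nat (n v) * v)" for v :: 'm by blast
  have a_int: "algebraic_int (to_ac a)" using assms(2) by (simp add: ring_of_integers_def algebraic_int_to_ac)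
  \<comment> \<open>The primitive element is built from algebraic integers, so the basis vectors are
    scaled first; the scaling is undone inside Q(\<theta>).\<close>
  define A where "A = (\<lambda>v. to_ac (of_nat (n v) * v)) ` B \<union> {x. poly (map_poly to_ac [:a, a, 0, 1:]) x = 0}"
  have "finite A" unfolding A_def using finite_Basis
    by (intro finite_UnI finite_imageI poly_roots_finite) (simp_all add: map_poly_pCons)
  moreover have "algebraic_int x" if "x \<in> A" for x
    using that n(2) a_int algebraic_int_cubic[of "to_ac a" x]
    unfolding A_def poly_trinomial by (auto intro: algebraic_int_to_ac simp del: to_ac_mult to_ac_of_nat)
  ultimately obtain \<theta> where \<theta>: "algebraic_int \<theta>" "A \<subseteq> rat_adjoin \<theta>"
    using primitive_element_finite_set by blast
  hence alg: "algebraic \<theta>" by (intro algebraic_int_imp_algebraic)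
  have "range to_ac \<subseteq> rat_adjoin \<theta>"
  proof safe
    fix y :: 'm
    have "to_ac v \<in> rat_adjoin \<theta>" if "v \<in> B" for v
    proof -
      have "to_ac v = to_ac (of_nat (n v) * v) / of_rat (of_nat (n v))" using n(1)[of v] by simp
      moreover have "to_ac (of_nat (n v) * v) \<in> rat_adjoin \<theta>" using \<theta>(2) that unfolding A_def by blast
      ultimately show ?thesis using alg by (simp only: rat_adjoin_divide rat_adjoin_of_rat)
    qed
    moreover obtain u where "y = (\<Sum>w\<in>B. of_rat (u w) * w)"
      using span_Basis span_finite[OF finite_Basis] by blast
    ultimately show "to_ac y \<in> rat_adjoin \<theta>"
      by (auto simp: to_ac_sum to_ac_of_rat intro!: rat_adjoin_sum rat_adjoin_mult rat_adjoin_of_rat)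
  qed
  hence split: "splitting_field [:a, a, 0, 1:] \<subseteq> rat_adjoin \<theta>"
    using \<theta>(2) alg unfolding A_def by (intro splitting_field_subset) auto
  define U where "U = {x \<in> range (rat_eval \<theta>). x \<noteq> 0 \<and> x \<noteq> 1 \<and> algebraic_int x \<and> algebraic_int (inverse x) \<and>
    algebraic_int (inverse (1 - x)) \<and> inverse x \<in> range (rat_eval \<theta>) \<and> inverse (1 - x) \<in> range (rat_eval \<theta>)}"
  have "finite U" unfolding U_def by (rule finite_exceptional_units_simple_extension[OF alg])
  \<comment> \<open>The sextic relation solved for b: each x belongs to exactly one b, so finitely
    many x leave finitely many b.\<close>
  define j where "j x = - ((x\<^sup>2 - x + 1) ^ 3) / (x\<^sup>2 * (1 - x)\<^sup>2)" for x :: "'m alg_closure"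
  \<comment> \<open>The value 0 is adjoined because quotients of roots require nonzero
    roots.\<close>
  have "to_ac b \<in> insert 0 (j ` U)"
    if b: "b \<in> ring_of_integers" "splitting_field [:a, a, 0, 1:] = splitting_field [:b, b, 0, 1:]" for b
  proof (cases "b = 0")
    case False
    have "t \<in> rat_adjoin \<theta>" if "t ^ 3 + to_ac b * t + to_ac b = 0" for t
      using split splitting_field_root[of "[:b, b, 0, 1:]" t] that unfolding b(2) poly_trinomial by blast
    then obtain x where x: "x \<in> rat_adjoin \<theta>" "x \<noteq> 0" "x \<noteq> 1"
      "to_ac b * x\<^sup>2 * (1 - x)\<^sup>2 + (x\<^sup>2 - x + 1) ^ 3 = 0"
      using trinomial_unit[of "to_ac b" \<theta>] False alg by auto
    have "algebraic_int (to_ac b)" using b(1) by (simp add: ring_of_integers_def algebraic_int_to_ac)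
    from sextic_units[OF this x(2-4)] have "x \<in> U"
      using x rat_adjoin_inverse[OF alg x(1)] rat_adjoin_inverse[OF alg rat_adjoin_diff[OF rat_adjoin_1 x(1)]]
      by (simp add: U_def rat_adjoin_def)
    moreover have "to_ac b = j x" using x(2-4) by (simp add: j_def field_simps eq_neg_iff_add_eq_0)
    ultimately show ?thesis by blast
  qed simp
  hence "to_ac ` {b \<in> ring_of_integers. splitting_field [:a, a, 0, 1:] = splitting_field [:b, b, 0, 1:]}
    \<subseteq> insert 0 (j ` U)" by blast
  moreover have "finite (insert 0 (j ` U))" using \<open>finite U\<close> by simp
  ultimately show ?thesis by (rule finite_imageD[OF finite_subset]) (simp add: inj_on_def)
qed

end
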